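(* Let $K:[0,1]\to\mathbb{R}$ be continuously differentiable with $K(0)\neq 0$, and for $t\in[0,1]$ let $g(t)\in L_2([0,1])$ be given by $g(t)(s)=K(t-s)1_{[0,t]}(s)$, $s\in[0,1]$. Then for every $k\ge 2$ the Rosen renormalized self-intersection local time of multiplicity $k$ exists (for the planar Volterra Gaussian process $Y$ associated with $g$), i.e., for every $h_1,h_2\in L_2([0,1])$ the integral $$\int_{\Delta_k}\prod_{i=1}^{k-1}\frac{1}{\|\tilde{\Delta}g(t_i)\|^2}\left(\exp\left(-\frac12\left(\|P_{\tilde{\Delta}g(t_i)}h_1\|^2+\|P_{\tilde{\Delta}g(t_i)}h_2\|^2\right)\right)-1\right)\,\mathrm{d}t_1\cdots\mathrm{d}t_k$$ converges.
   Context: $\Delta_k=\{(t_1,\ldots,t_k):0\le t_1\le\ldots\le t_k\le 1\}$. For $t_1<\ldots<t_k$, $\Delta g(t_i)=g(t_{i+1})-g(t_i)$, $i=1,\ldots,k-1$, and $\tilde{\Delta}g(t_1),\ldots,\tilde{\Delta}g(t_{k-1})$ is the orthogonal system (not normalized) obtained from $\Delta g(t_1),\ldots,\Delta g(t_{k-1})$ by the Gram–Schmidt procedure in $L_2([0,1])$: $\tilde{\Delta}g(t_1)=\Delta g(t_1)$ and $\tilde{\Delta}g(t_i)$ is $\Delta g(t_i)$ minus its orthogonal projection onto the linear span of $\Delta g(t_1),\ldots,\Delta g(t_{i-1})$. $P_e$ denotes the orthogonal projection in $L_2([0,1])$ onto the linear span of $e$, and $\|\cdot\|$ is the norm of $L_2([0,1])$.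 The process $Y$ is $Y(t)=\left(\int_0^tK(t-s)\,\mathrm{d}W_1(s),\int_0^tK(t-s)\,\mathrm{d}W_2(s)\right)$, $t\in[0,1]$, with $W_1,W_2$ independent Wiener processes; existence of its Rosen renormalized self-intersection local time of multiplicity $k$ means, by definition here, convergence of the displayed integral (the Rosen renormalized Fourier–Wiener transform, up to the constant $(2\pi)^{-(k-1)}$) for all $h_1,h_2\in L_2([0,1])$. *)

theory Defs
  imports "HOL-Analysis.Analysis"
begin

section \<open>The space $L_2([0,1])$\<close>

abbreviation unit_leb :: "real measure" where
  "unit_leb \<equiv> lebesgue_on {0..1}"

definition sq_int :: "(real \<Rightarrow> real) \<Rightarrow> bool" where
  "sq_int f \<longleftrightarrow> f \<in> borel_measurable unit_leb \<and> integrable unit_leb (\<lambda>s. (f s)\<^sup>2)"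

definition L2_rel :: "(real \<Rightarrow> real) \<Rightarrow> (real \<Rightarrow> real) \<Rightarrow> bool" where
  "L2_rel f h \<longleftrightarrow> sq_int f \<and> sq_int h \<and> (AE s in unit_leb. f s = h s)"

lemma sq_int_zero: "sq_int (\<lambda>_. 0)"
  by (simp add: sq_int_def)

lemma sq_int_mult:
  assumes "sq_int f" "sq_int h"
  shows "integrable unit_leb (\<lambda>s. f s * h s)"
proof -
  have "integrable unit_leb (\<lambda>s. (f s)\<^sup>2 + (h s)\<^sup>2)"
    and m: "(\<lambda>s. f s * h s) \<in> borel_measurable unit_leb"
    using assms by (auto simp: sq_int_def)
  then show ?thesis
  proof (rule Bochner_Integration.integrable_bound, intro AE_I2)
    fix s
    have "2 * \<bar>f s\<bar> * \<bar>h s\<bar> \<le> \<bar>f s\<bar>\<^sup>2 + \<bar>h s\<bar>\<^sup>2"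
      by (rule sum_squares_bound)
    moreover have "0 \<le> \<bar>f s\<bar> * \<bar>h s\<bar>"
      by simp
    ultimately have "\<bar>f s\<bar> * \<bar>h s\<bar> \<le> (f s)\<^sup>2 + (h s)\<^sup>2"
      by (simp only: power2_abs mult.assoc)
    then show "norm (f s * h s) \<le> norm ((f s)\<^sup>2 + (h s)\<^sup>2)"
      by (simp add: abs_mult)
  qed
qed

lemma sq_int_add:
  assumes "sq_int f" "sq_int h"
  shows "sq_int (\<lambda>s. f s + h s)"
proof -
  have "integrable unit_leb (\<lambda>s. (f s)\<^sup>2 + (h s)\<^sup>2 + 2 * (f s * h s))"
    using assms sq_int_mult[OF assms] by (simp add: sq_int_def)
  then show ?thesis
    using assms by (auto simp: sq_int_def power2_sum mult.assoc intro: borel_measurable_add)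
qed

lemma sq_int_scale: "sq_int f \<Longrightarrow> sq_int (\<lambda>s. c * f s)"
  by (auto simp: sq_int_def power_mult_distrib intro: borel_measurable_times)

quotient_type L2 = "real \<Rightarrow> real" / partial: L2_rel
  morphisms rep_L2 to_L2
proof (rule part_equivpI)
  show "\<exists>f. L2_rel f f"
    using sq_int_zero by (auto simp: L2_rel_def)
  show "symp L2_rel"
    by (auto simp: L2_rel_def symp_def)
  show "transp L2_rel"
    by (auto simp: L2_rel_def transp_def elim: eventually_elim2)
qed

instantiation L2 :: real_inner
begin

lift_definition zero_L2 :: L2 is "\<lambda>_. 0"
  by (simp add: L2_rel_def sq_int_zero)

lift_definition plus_L2 :: "L2 \<Rightarrow> L2 \<Rightarrow> L2" is "\<lambda>f h s. f s + h s"
  by (auto simp: L2_rel_def sq_int_add elim: eventually_elim2)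

lift_definition scaleR_L2 :: "real \<Rightarrow> L2 \<Rightarrow> L2" is "\<lambda>c f s. c * f s"
  by (auto simp: L2_rel_def sq_int_scale elim: eventually_mono)

definition uminus_L2 :: "L2 \<Rightarrow> L2" where "- x = (-1) *\<^sub>R (x :: L2)"

definition minus_L2 :: "L2 \<Rightarrow> L2 \<Rightarrow> L2" where "x - y = x + - (y :: L2)"

lift_definition inner_L2 :: "L2 \<Rightarrow> L2 \<Rightarrow> real" is
  "\<lambda>f h. \<integral>s. f s * h s \<partial>unit_leb"
  by (rule integral_cong_AE) (auto simp: L2_rel_def sq_int_def elim: eventually_elim2)

definition norm_L2 :: "L2 \<Rightarrow> real" where "norm_L2 x = sqrt (inner x x)"

definition dist_L2 :: "L2 \<Rightarrow> L2 \<Rightarrow> real" where "dist_L2 x y = norm (x - y)"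

definition sgn_L2 :: "L2 \<Rightarrow> L2" where "sgn_L2 x = inverse (norm x) *\<^sub>R x"

definition uniformity_L2 :: "(L2 \<times> L2) filter" where
  "uniformity_L2 = (INF e\<in>{0<..}. principal {(x, y). dist x y < e})"

definition open_L2 :: "L2 set \<Rightarrow> bool" where
  "open_L2 U \<longleftrightarrow> (\<forall>x\<in>U. eventually (\<lambda>(x', y). x' = x \<longrightarrow> y \<in> U) uniformity)"

instance
proof
  fix x y z :: L2 and a b :: real
  show "x + y + z = x + (y + z)"
    by transfer (auto simp: L2_rel_def add.assoc intro!: sq_int_add)
  show "x + y = y + x"
    by transfer (auto simp: L2_rel_def add.commute intro!: sq_int_add)
  show "0 + x = x"
    by transfer (auto simp: L2_rel_def)
  show "- x + x = 0"
    unfolding uminus_L2_def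
    by transfer (auto simp: L2_rel_def sq_int_zero)
  show "x - y = x + - y"
    by (rule minus_L2_def)
  show "a *\<^sub>R (x + y) = a *\<^sub>R x + a *\<^sub>R y"
    by transfer (auto simp: L2_rel_def distrib_left intro!: sq_int_add sq_int_scale)
  show "(a + b) *\<^sub>R x = a *\<^sub>R x + b *\<^sub>R x"
    by transfer (auto simp: L2_rel_def distrib_right intro!: sq_int_add sq_int_scale)
  show "a *\<^sub>R b *\<^sub>R x = (a * b) *\<^sub>R x"
    by transfer (auto simp: L2_rel_def mult.assoc intro!: sq_int_scale)
  show "1 *\<^sub>R x = x"
    by transfer (auto simp: L2_rel_def)
  show "sgn x = inverse (norm x) *\<^sub>R x"
    by (rule sgn_L2_def)
  show "dist x y = norm (x - y)"
    by (rule dist_L2_def)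
  show "(uniformity :: (L2 \<times> L2) filter) = (INF e\<in>{0<..}. principal {(x, y). dist x y < e})"
    by (rule uniformity_L2_def)
  show "open U \<longleftrightarrow> (\<forall>x\<in>U. eventually (\<lambda>(x', y). x' = x \<longrightarrow> y \<in> U) uniformity)" for U :: "L2 set"
    by (rule open_L2_def)
  show "inner x y = inner y x"
    by transfer (simp add: mult.commute)
  show "inner (x + y) z = inner x z + inner y z"
    by transfer (simp add: L2_rel_def distrib_right sq_int_mult)
  show "inner (a *\<^sub>R x) y = a * inner x y"
    by transfer (simp add: mult.assoc)
  show "0 \<le> inner x x"
    by transfer simp
  show "inner x x = 0 \<longleftrightarrow> x = 0"
  proof transfer
    fix f assume f: "L2_rel f f"
    then have "integrable unit_leb (\<lambda>s. f s * f s)"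
      by (simp add: L2_rel_def sq_int_mult)
    then have "(\<integral>s. f s * f s \<partial>unit_leb) = 0 \<longleftrightarrow> (AE s in unit_leb. f s * f s = 0)"
      by (rule integral_nonneg_eq_0_iff_AE) simp
    then show "(\<integral>s. f s * f s \<partial>unit_leb) = 0 \<longleftrightarrow> L2_rel f (\<lambda>_. 0)"
      using f by (simp add: L2_rel_def sq_int_zero)
  qed
  show "norm x = sqrt (inner x x)"
    by (rule norm_L2_def)
qed

end

section \<open>Orthogonal projections and the Gram--Schmidt system of increments\<close>

text \<open>The description is proper whenever the projection exists, in particular for every
  finite-dimensional subspace \<open>V\<close>.\<close>

definition orth_proj :: "'a::real_inner set \<Rightarrow> 'a \<Rightarrow> 'a" where
  "orth_proj V x = (THE p. p \<in> V \<and> (\<forall>v\<in>V. orthogonal (x - p) v))"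

definition incr :: "(real \<Rightarrow> L2) \<Rightarrow> (nat \<Rightarrow> real) \<Rightarrow> nat \<Rightarrow> L2" where
  "incr g t i = g (t (i + 1)) - g (t i)"

definition orth_incr :: "(real \<Rightarrow> L2) \<Rightarrow> (nat \<Rightarrow> real) \<Rightarrow> nat \<Rightarrow> L2" where
  "orth_incr g t i = incr g t i - orth_proj (span (incr g t ` {1..<i})) (incr g t i)"

section \<open>Rosen renormalized self-intersection local time\<close>

definition time_simplex :: "nat \<Rightarrow> (nat \<Rightarrow> real) set" where
  "time_simplex k = {t \<in> {1..k} \<rightarrow>\<^sub>E {0..1}. mono_on {1..k} t}"

text \<open>Where two consecutive times coincide, some \<open>orth_incr g t i\<close> vanishes and the integrand is
  \<open>0\<close> because \<open>1 / 0 = 0\<close>; this concerns a null set of the simplex only.\<close>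

definition rosen_integrand :: "(real \<Rightarrow> L2) \<Rightarrow> nat \<Rightarrow> L2 \<Rightarrow> L2 \<Rightarrow> (nat \<Rightarrow> real) \<Rightarrow> real" where
  "rosen_integrand g k h1 h2 t =
    (\<Prod>i = 1..k - 1.
       1 / (norm (orth_incr g t i))\<^sup>2 *
       (exp (- (1 / 2) * ((norm (orth_proj (span {orth_incr g t i}) h1))\<^sup>2
                        + (norm (orth_proj (span {orth_incr g t i}) h2))\<^sup>2)) - 1))"

text \<open>Each of the \<open>k - 1\<close> factors of the integrand is nonpositive, so the integrand has constant
  sign and convergence of its integral amounts to Lebesgue integrability.  The local time of the
  process associated with \<open>g\<close> exists, by definition, if these integrals converge.\<close>

definition rosen_local_time_exists :: "(real \<Rightarrow> L2) \<Rightarrow> nat \<Rightarrow> bool" where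
  "rosen_local_time_exists g k \<longleftrightarrow>
    (\<forall>h1 h2 :: L2. set_integrable (Pi\<^sub>M {1..k} (\<lambda>_. lborel)) (time_simplex k)
       (rosen_integrand g k h1 h2))"

end

theory Submission
  imports Defs
begin

text \<open>For \<open>s = t i < u = t (i + 1)\<close> the increment \<open>g u - g s\<close> is \<open>a + b\<close> with
  \<open>b = K (u - \<cdot>) 1_(s,u]\<close> orthogonal to \<open>a\<close> and to all earlier increments.  Hence the
  orthogonalised increment \<open>e\<close> satisfies \<open>|e|^2 \<ge> |b|^2 \<ge> c (u - s)\<close>, since \<open>K 0 \<noteq> 0\<close>, and
  \<open>|\<langle>h, e\<rangle>| \<le> |\<langle>h, b\<rangle>| + |h| |a|\<close>, where \<open>|a| \<le> L (u - s)\<close> because \<open>K\<close> is Lipschitz.  As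
  \<open>1 - exp (- x) \<le> x\<close>, the \<open>i\<close>-th factor is at most a constant times
  \<open>(\<langle>h1, b\<rangle>^2 + \<langle>h2, b\<rangle>^2) / (u - s)^2 + 1\<close>.  Its integral over \<open>u\<close> is bounded uniformly in \<open>s\<close> by
  Hardy's inequality, so integrating out the last time variable repeatedly gives a finite
  bound.\<close>

section \<open>Gram--Schmidt orthogonalisation of increments\<close>

text \<open>The difference of two candidates lies in \<open>V\<close> and is orthogonal to itself,
  so it is zero. This turns the description in \<open>orth_proj\<close> into a usable
  characterisation, without completeness of the space.\<close>

lemma orth_proj_eqI:
  assumes "subspace V" "p \<in> V" "\<And>v. v \<in> V \<Longrightarrow> orthogonal (x - p) v"
  shows "orth_proj V x = p"
  unfolding orth_proj_def
proof (rule the_equality)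
  show "p \<in> V \<and> (\<forall>v\<in>V. orthogonal (x - p) v)"
    using assms by blast
next
  fix q assume q: "q \<in> V \<and> (\<forall>v\<in>V. orthogonal (x - q) v)"
  with assms have "q - p \<in> V"
    by (simp add: subspace_diff)
  with q assms have "inner (x - p) (q - p) = 0" "inner (x - q) (q - p) = 0"
    by (auto simp: orthogonal_def)
  then have "inner (q - p) (q - p) = 0"
    by (simp add: inner_diff)
  then show "q = p"
    by simp
qed

text \<open>Fourier expansion in an orthogonal family. Zero vectors are allowed: their coefficient
  is \<open>0\<close> because \<open>x / 0 = 0\<close>.\<close>

lemma orth_proj_span_orthogonal:
  fixes e :: "'b \<Rightarrow> 'a::real_inner"
  assumes "finite J" and orth: "\<And>i j. i \<in> J \<Longrightarrow> j \<in> J \<Longrightarrow> i \<noteq> j \<Longrightarrow> inner (e i) (e j) = 0"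
  shows "orth_proj (span (e ` J)) x = (\<Sum>j\<in>J. (inner x (e j) / inner (e j) (e j)) *\<^sub>R e j)"
    (is "_ = ?p")
proof (rule orth_proj_eqI)
  show "?p \<in> span (e ` J)"
    by (intro span_sum span_scale span_base) auto
  fix v assume "v \<in> span (e ` J)"
  then show "orthogonal (x - ?p) v"
  proof (rule orthogonal_to_span)
    fix w assume "w \<in> e ` J"
    then obtain i where i: "i \<in> J" "w = e i"
      by blast
    have "inner ?p (e i) = (\<Sum>j\<in>J. inner x (e j) / inner (e j) (e j) * inner (e j) (e i))"
      by (simp add: inner_sum_left)
    \<comment> \<open>For \<open>j = i\<close> the quotient cancels; if \<open>e i = 0\<close>, both
      sides are \<open>0\<close>.\<close>
    also have "\<dots> = (\<Sum>j\<in>J. if j = i then inner x (e i) else 0)"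
      using orth i by (intro sum.cong) auto
    also have "\<dots> = inner x (e i)"
      using assms i by simp
    finally show "orthogonal (x - ?p) w"
      by (simp add: orthogonal_def inner_diff i)
  qed
qed auto

text \<open>A one-element instance of the Fourier expansion, which replaces the projections in the
  integrand by inner products. For \<open>e = 0\<close> both sides vanish.\<close>

lemma norm_orth_proj_span_singleton:
  fixes e :: "'a::real_inner"
  shows "(norm (orth_proj (span {e}) x))\<^sup>2 = (inner x e)\<^sup>2 / (norm e)\<^sup>2"
proof -
  have "orth_proj (span {e}) x = (inner x e / inner e e) *\<^sub>R e"
    using orth_proj_span_orthogonal[of "{()}" "\<lambda>_. e" x] by simp
  then show ?thesis
    by (simp add: power_divide power2_norm_eq_inner[symmetric] power2_eq_square)
qed

text \<open>Both claims go through one induction: the span equality lets the projection of the next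
  increment be expanded in the earlier orthogonalised increments, whose orthogonality makes this
  expansion valid.\<close>

lemma gram_schmidt_incr:
  shows orth_incr_orthogonal: "i \<in> {1..<n} \<Longrightarrow> j \<in> {1..<n} \<Longrightarrow> i \<noteq> j \<Longrightarrow>
      inner (orth_incr g t i) (orth_incr g t j) = 0"
    and span_orth_incr: "span (orth_incr g t ` {1..<n}) = span (incr g t ` {1..<n})"
proof (induction n arbitrary: i j)
  case (Suc n)
  define e where "e = orth_incr g t"
  define d where "d = incr g t"
  define p where "p = orth_proj (span (d ` {1..<n})) (d n)"
  have en: "e n = d n - p"
    by (simp add: e_def d_def p_def orth_incr_def)
  have sp: "span (e ` {1..<n}) = span (d ` {1..<n})"
    using Suc.IH(2) by (simp add: e_def d_def)
  have p: "p = (\<Sum>j\<in>{1..<n}. (inner (d n) (e j) / inner (e j) (e j)) *\<^sub>R e j)"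
    unfolding p_def sp[symmetric]
    by (rule orth_proj_span_orthogonal) (use Suc.IH(1) in \<open>auto simp: e_def\<close>)
  have pV: "p \<in> span (e ` {1..<n})"
    unfolding p by (intro span_sum span_scale span_base) auto
  have new: "inner (e n) (e i) = 0" if i: "i \<in> {1..<n}" for i
  proof -
    have "inner p (e i) = (\<Sum>j\<in>{1..<n}. inner (d n) (e j) / inner (e j) (e j) * inner (e j) (e i))"
      by (simp add: p inner_sum_left)
    also have "\<dots> = (\<Sum>j\<in>{1..<n}. if j = i then inner (d n) (e i) else 0)"
      using Suc.IH(1) i by (intro sum.cong) (auto simp: e_def)
    also have "\<dots> = inner (d n) (e i)"
      using i by simp
    finally show ?thesis
      by (simp add: en inner_diff)
  qed
  { case 1
    then show ?case
      using new[of i] new[of j] Suc.IH(1)[of i j]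
      by (auto simp: e_def less_Suc_eq inner_commute) }
  { case 2
    show ?case
    proof (cases "n = 0")
      case False
      then have "{1..<Suc n} = insert n {1..<n}"
        by auto
      \<comment> \<open>The vectors \<open>e n\<close> and \<open>d n\<close> differ by
        \<open>p\<close>, which already lies in the earlier span.\<close>
      moreover have "span (insert (e n) (e ` {1..<n})) = span (insert (d n) (e ` {1..<n}))"
        using pV span_neg[OF pV] by (intro eq_span_insert_eq) (simp add: en)
      moreover have "span (insert (d n) (e ` {1..<n})) = span (insert (d n) (d ` {1..<n}))"
        using sp by (metis span_insert)
      ultimately show ?thesis
        by (simp add: e_def d_def)
    qed simp }
qed simp_all

text \<open>Zero vectors contribute nothing to the sum because \<open>x / 0 = 0\<close>, so this holds for linearly
  dependent increments as well, and makes the Gram--Schmidt system Borel measurable in \<open>t\<close>.\<close>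

lemma orth_incr_eq_sum:
  "orth_incr g t i = incr g t i -
    (\<Sum>j\<in>{1..<i}. (inner (incr g t i) (orth_incr g t j) / inner (orth_incr g t j) (orth_incr g t j))
      *\<^sub>R orth_incr g t j)"
proof -
  have "orth_proj (span (orth_incr g t ` {1..<i})) (incr g t i) =
    (\<Sum>j\<in>{1..<i}. (inner (incr g t i) (orth_incr g t j) / inner (orth_incr g t j) (orth_incr g t j))
      *\<^sub>R orth_incr g t j)"
    by (rule orth_proj_span_orthogonal) (auto intro: orth_incr_orthogonal)
  then show ?thesis
    unfolding span_orth_incr by (subst orth_incr_def) (rule arg_cong)
qed

lemma orth_incr_orthogonal_span:
  assumes "v \<in> span (incr g t ` {1..<i})"
  shows "inner (orth_incr g t i) v = 0"
proof -
  have "v \<in> span (orth_incr g t ` {1..<i})"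
    using assms by (simp only: span_orth_incr)
  then have "orthogonal (orth_incr g t i) v"
  proof (rule orthogonal_to_span)
    fix w assume "w \<in> orth_incr g t ` {1..<i}"
    then show "orthogonal (orth_incr g t i) w"
      using orth_incr_orthogonal[of i "Suc i" _ g t] by (auto simp: orthogonal_def)
  qed
  then show ?thesis
    by (simp add: orthogonal_def)
qed

lemma incr_minus_orth_incr_in_span:
  "incr g t i - orth_incr g t i \<in> span (incr g t ` {1..<i})"
proof -
  have "incr g t i - orth_incr g t i =
    (\<Sum>j\<in>{1..<i}. (inner (incr g t i) (orth_incr g t j) / inner (orth_incr g t j) (orth_incr g t j))
      *\<^sub>R orth_incr g t j)"
    by (subst orth_incr_eq_sum[of g t i]) simp
  also have "\<dots> \<in> span (orth_incr g t ` {1..<i})"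
    by (intro span_sum span_scale span_base imageI)
  finally show ?thesis
    by (simp only: span_orth_incr)
qed

text \<open>The increment differs from its orthogonalisation by an element of the earlier span. The
  squared norm thus becomes a pairing with a plain increment, which the measurability induction can
  handle.\<close>

lemma inner_orth_incr_self:
  "inner (orth_incr g t i) (orth_incr g t i) = inner (orth_incr g t i) (incr g t i)"
  using orth_incr_orthogonal_span[OF incr_minus_orth_incr_in_span, of g t i]
  by (simp add: inner_diff_right)

text \<open>Since \<open>b\<close> is orthogonal to the earlier span, the projection removes only a
  part \<open>p\<close> of \<open>a\<close>. With \<open>e = (a - p) + b\<close>, Pythagoras gives
  the lower bound; Cauchy--Schwarz and \<open>norm (a - p) \<le> norm a\<close> give the upper
  one.\<close>

lemma orth_incr_split:
  assumes "incr g t i = a + b" "inner b a = 0"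
    and b: "\<And>j. j \<in> {1..<i} \<Longrightarrow> inner b (incr g t j) = 0"
  shows norm_orth_incr_ge: "(norm b)\<^sup>2 \<le> (norm (orth_incr g t i))\<^sup>2"
    and inner_orth_incr_le: "(inner h (orth_incr g t i))\<^sup>2 \<le> 2 * (inner h b)\<^sup>2 + 2 * (norm h)\<^sup>2 * (norm a)\<^sup>2"
proof -
  define e where "e = orth_incr g t i"
  define p where "p = incr g t i - e"
  have p: "p \<in> span (incr g t ` {1..<i})"
    unfolding p_def e_def by (rule incr_minus_orth_incr_in_span)
  have "orthogonal b p"
    using p by (rule orthogonal_to_span) (auto simp: orthogonal_def b)
  then have bp: "inner b p = 0"
    by (simp add: orthogonal_def)
  have ep: "inner e p = 0"
    unfolding e_def by (rule orth_incr_orthogonal_span[OF p])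
  have e: "e = (a - p) + b"
    using assms(1) by (simp add: p_def)
  \<comment> \<open>Both \<open>e\<close> and \<open>b\<close> are orthogonal to \<open>p\<close>,
    hence so is \<open>e - b = a - p\<close>; thus \<open>p\<close> is also the projection of
    \<open>a\<close>.\<close>
  have "inner (a - p) p = 0"
    using ep bp unfolding e by (simp add: inner_add_left)
  then have "inner a a = inner (a - p) (a - p) + inner p p"
    by (simp add: inner_diff inner_commute)
  then have ap: "norm (a - p) \<le> norm a"
    by (simp add: norm_le)
  have "inner e e = inner (a - p) (a - p) + inner b b"
    using bp assms(2) by (simp add: e inner_add inner_diff inner_commute)
  then show "(norm b)\<^sup>2 \<le> (norm (orth_incr g t i))\<^sup>2"
    by (simp add: e_def power2_norm_eq_inner)
  have "\<bar>inner h (a - p)\<bar> \<le> norm h * norm (a - p)"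
    by (rule Cauchy_Schwarz_ineq2)
  also have "\<dots> \<le> norm h * norm a"
    using ap by (simp add: mult_left_mono)
  finally have "\<bar>inner h (a - p)\<bar>\<^sup>2 \<le> (norm h * norm a)\<^sup>2"
    by (rule power_mono) simp
  moreover have "(inner h e)\<^sup>2 \<le> 2 * (inner h b)\<^sup>2 + 2 * (inner h (a - p))\<^sup>2"
    using sum_squares_bound[of "inner h b" "inner h (a - p)"]
    by (simp add: e inner_add_right power2_sum mult.commute mult.left_commute)
  ultimately show "(inner h (orth_incr g t i))\<^sup>2 \<le> 2 * (inner h b)\<^sup>2 + 2 * (norm h)\<^sup>2 * (norm a)\<^sup>2"
    by (simp add: e_def power_mult_distrib)
qed

section \<open>Hardy's inequality and iterated integrals\<close>

lemma nn_integral_powr_neg_three_halves_le: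
  fixes r s :: real
  assumes "s < r" "r \<le> 1"
  shows "(\<integral>\<^sup>+ t. ennreal (1 / ((t - s) * sqrt (t - s))) * indicator {r..1} t \<partial>lborel) \<le> ennreal (2 / sqrt (r - s))"
proof -
  have "((\<lambda>t. 1 / ((t - s) * sqrt (t - s))) has_integral (- 2 / sqrt (1 - s)) - (- 2 / sqrt (r - s))) {r..1}"
  proof (rule fundamental_theorem_of_calculus)
    fix t assume "t \<in> {r..1}"
    then have "t - s > 0"
      using assms by auto
    then show "((\<lambda>t. - 2 / sqrt (t - s)) has_vector_derivative 1 / ((t - s) * sqrt (t - s))) (at t within {r..1})"
      unfolding has_real_derivative_iff_has_vector_derivative[symmetric]
      by (auto intro!: derivative_eq_intros simp: field_simps)
  qed (use assms in auto)
  moreover have "1 / ((t - s) * sqrt (t - s)) \<ge> 0" if "t \<in> {r..1}" for t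
    using that assms by auto
  ultimately have "(\<integral>\<^sup>+ t. ennreal (1 / ((t - s) * sqrt (t - s))) * indicator {r..1} t \<partial>lborel)
      = ennreal ((- 2 / sqrt (1 - s)) - (- 2 / sqrt (r - s)))"
    by (intro nn_integral_has_integral_lebesgue') auto
  \<comment> \<open>The boundary term at \<open>1\<close> is nonpositive and is dropped.\<close>
  also have "\<dots> \<le> ennreal (2 / sqrt (r - s))"
    using assms by (intro ennreal_leI) simp
  finally show ?thesis .
qed

lemma nn_integral_inverse_sqrt:
  fixes s t :: real
  assumes "s \<le> t"
  shows "(\<integral>\<^sup>+ r. ennreal (1 / sqrt (r - s)) * indicator {s..t} r \<partial>lborel) = ennreal (2 * sqrt (t - s))"
proof -
  have "((\<lambda>r. 1 / sqrt (r - s)) has_integral 2 * sqrt (t - s) - 2 * sqrt (s - s)) {s..t}"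
  \<comment> \<open>The integrand is singular at \<open>r = s\<close>; the interior form only asks
    for continuity of the antiderivative at the endpoints.\<close>
  proof (rule fundamental_theorem_of_calculus_interior)
    fix r assume "r \<in> {s<..<t}"
    then have "r - s > 0"
      using assms by auto
    then show "((\<lambda>r. 2 * sqrt (r - s)) has_vector_derivative 1 / sqrt (r - s)) (at r)"
      unfolding has_real_derivative_iff_has_vector_derivative[symmetric]
      by (auto intro!: derivative_eq_intros simp: field_simps)
  qed (use assms in \<open>auto intro!: continuous_intros\<close>)
  then have "(\<integral>\<^sup>+ r. ennreal (1 / sqrt (r - s)) * indicator {s..t} r \<partial>lborel)
      = ennreal (2 * sqrt (t - s) - 2 * sqrt (s - s))"
    by (intro nn_integral_has_integral_lebesgue') auto
  then show ?thesis
    by simp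
qed

text \<open>With \<open>q\<close> the square of \<open>h\<close>, this is, up to a constant, the
  weighted Cauchy--Schwarz bound for the squared inner product of \<open>h\<close> with the
  innovation, divided by \<open>(t - s)^2\<close>. Values in \<open>ennreal\<close> allow Tonelli
  before finiteness is known.\<close>

definition hardy_kernel :: "(real \<Rightarrow> ennreal) \<Rightarrow> real \<Rightarrow> real \<Rightarrow> ennreal" where
  "hardy_kernel q s t = ennreal (1 / ((t - s) * sqrt (t - s))) *
     (\<integral>\<^sup>+ r. q r * ennreal (sqrt (r - s)) * indicator {s<..t} r \<partial>lborel)"

lemma measurable_hardy_kernel [measurable]:
  assumes [measurable]: "q \<in> borel_measurable borel"
  shows "(\<lambda>(s, t). hardy_kernel q s t) \<in> borel_measurable (borel \<Otimes>\<^sub>M borel)"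
proof -
  \<comment> \<open>The interval with moving endpoints becomes a condition on the triple
    \<open>s\<close>, \<open>r\<close>, \<open>t\<close>, so that joint measurability is
    visible.\<close>
  have *: "hardy_kernel q s t = ennreal (1 / ((t - s) * sqrt (t - s))) *
     (\<integral>\<^sup>+ r. q r * ennreal (sqrt (r - s)) * (if s < r \<and> r \<le> t then 1 else 0) \<partial>lborel)" for s t
    unfolding hardy_kernel_def by (intro arg_cong2[where f="(*)"] nn_integral_cong) auto
  show ?thesis
    unfolding * by measurable
qed

text \<open>By Tonelli, the weight \<open>sqrt (r - s)\<close> cancels the singularity of the inner integral.\<close>

lemma nn_integral_hardy_kernel_le:
  assumes [measurable]: "q \<in> borel_measurable borel"
  shows "(\<integral>\<^sup>+ t. hardy_kernel q s t * indicator {s<..1} t \<partial>lborel) \<le> 2 * (\<integral>\<^sup>+ r. q r \<partial>lborel)"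
proof -
  define c where "c t = ennreal (1 / ((t - s) * sqrt (t - s)))" for t
  have [measurable]: "c \<in> borel_measurable borel"
    unfolding c_def by measurable
  have "(\<integral>\<^sup>+ t. hardy_kernel q s t * indicator {s<..1} t \<partial>lborel)
      = (\<integral>\<^sup>+ t. \<integral>\<^sup>+ r. c t * (q r * ennreal (sqrt (r - s)) * (if s < r \<and> r \<le> t \<and> t \<le> 1 then 1 else 0)) \<partial>lborel \<partial>lborel)"
  proof (rule nn_integral_cong)
    fix t
    have "hardy_kernel q s t * indicator {s<..1} t =
        (\<integral>\<^sup>+ r. c t * (q r * ennreal (sqrt (r - s)) * indicator {s<..t} r) \<partial>lborel) * indicator {s<..1} t"
      unfolding hardy_kernel_def c_def by (subst nn_integral_cmult) auto
    also have "\<dots> = (\<integral>\<^sup>+ r. c t * (q r * ennreal (sqrt (r - s)) * indicator {s<..t} r) * indicator {s<..1} t \<partial>lborel)"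
      by (subst nn_integral_multc) auto
    also have "\<dots> = (\<integral>\<^sup>+ r. c t * (q r * ennreal (sqrt (r - s)) * (if s < r \<and> r \<le> t \<and> t \<le> 1 then 1 else 0)) \<partial>lborel)"
      by (intro nn_integral_cong) (auto simp: indicator_def)
    finally show "hardy_kernel q s t * indicator {s<..1} t = \<dots>" .
  qed
  also have "\<dots> = (\<integral>\<^sup>+ r. \<integral>\<^sup>+ t. c t * (q r * ennreal (sqrt (r - s)) * (if s < r \<and> r \<le> t \<and> t \<le> 1 then 1 else 0)) \<partial>lborel \<partial>lborel)"
    by (rule lborel_pair.Fubini') measurable
  also have "\<dots> \<le> (\<integral>\<^sup>+ r. 2 * q r \<partial>lborel)"
  proof (rule nn_integral_mono)
    fix r
    show "(\<integral>\<^sup>+ t. c t * (q r * ennreal (sqrt (r - s)) * (if s < r \<and> r \<le> t \<and> t \<le> 1 then 1 else 0)) \<partial>lborel) \<le> 2 * q r"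
    proof (cases "s < r \<and> r \<le> 1")
      case True
      have "(\<integral>\<^sup>+ t. c t * (q r * ennreal (sqrt (r - s)) * (if s < r \<and> r \<le> t \<and> t \<le> 1 then 1 else 0)) \<partial>lborel)
          = (\<integral>\<^sup>+ t. q r * ennreal (sqrt (r - s)) * (c t * indicator {r..1} t) \<partial>lborel)"
        using True by (intro nn_integral_cong) (auto simp: indicator_def mult_ac)
      also have "\<dots> = q r * ennreal (sqrt (r - s)) * (\<integral>\<^sup>+ t. c t * indicator {r..1} t \<partial>lborel)"
        by (rule nn_integral_cmult) measurable
      also have "\<dots> \<le> q r * ennreal (sqrt (r - s)) * ennreal (2 / sqrt (r - s))"
        unfolding c_def using True
        by (intro mult_left_mono nn_integral_powr_neg_three_halves_le) auto
      also have "\<dots> = q r * ennreal (sqrt (r - s) * (2 / sqrt (r - s)))"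
        by (subst ennreal_mult'') (use True in \<open>auto simp: mult.assoc\<close>)
      also have "\<dots> = 2 * q r"
        using True by (simp add: mult.commute)
      finally show ?thesis .
    next
      case False
      then have "(\<integral>\<^sup>+ t. c t * (q r * ennreal (sqrt (r - s)) * (if s < r \<and> r \<le> t \<and> t \<le> 1 then 1 else 0)) \<partial>lborel)
         = (\<integral>\<^sup>+ t. 0 \<partial>(lborel :: real measure))"
        by (intro nn_integral_cong) auto
      then show ?thesis
        by simp
    qed
  qed
  also have "\<dots> = 2 * (\<integral>\<^sup>+ r. q r \<partial>lborel)"
    by (rule nn_integral_cmult) measurable
  finally show ?thesis .
qed

section \<open>Iterated integration along a chain of times\<close>

text \<open>The last variable occurs only in the last factor, so integrating it out costs one factor
  \<open>B\<close>, uniformly in the remaining variables. The first variable contributes the length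
  \<open>1\<close> of the unit interval.\<close>

lemma nn_integral_PiM_chain_le:
  fixes F :: "real \<Rightarrow> real \<Rightarrow> ennreal"
  assumes [measurable]: "(\<lambda>(s, t). F s t) \<in> borel_measurable (borel \<Otimes>\<^sub>M borel)"
    and B: "\<And>s. (\<integral>\<^sup>+ t. F s t \<partial>lborel) \<le> B"
  shows "(\<integral>\<^sup>+ t. indicator {0..1} (t 1) * (\<Prod>i\<in>{1..n}. F (t i) (t (i + 1))) \<partial>Pi\<^sub>M {1..Suc n} (\<lambda>_. lborel)) \<le> B ^ n"
proof (induction n)
  case 0
  interpret product_sigma_finite "\<lambda>_::nat. lborel :: real measure" ..
  have "(\<integral>\<^sup>+ t. indicator {0..1} (t (1::nat)) \<partial>Pi\<^sub>M {1} (\<lambda>_. lborel :: real measure)) = (\<integral>\<^sup>+ x. indicator {0..1::real} x \<partial>lborel)"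
    by (rule product_nn_integral_singleton[where f="indicator {0..1}"]) measurable
  then show ?case
    by simp
next
  case (Suc n)
  interpret product_sigma_finite "\<lambda>_::nat. lborel :: real measure" ..
  have ins: "{1..Suc (Suc n)} = insert (Suc (Suc n)) {1..Suc n}"
    by auto
  have meas: "(\<lambda>t. indicator {0..1} (t 1) * (\<Prod>i\<in>{1..m}. F (t i) (t (i + 1)))) \<in> borel_measurable (Pi\<^sub>M {1..Suc m} (\<lambda>_. lborel))" for m
  proof -
    have "(\<lambda>t. F (t i) (t (i + 1))) \<in> borel_measurable (Pi\<^sub>M {1..Suc m} (\<lambda>_. lborel))" if "i \<in> {1..m}" for i
    proof -
      have "(\<lambda>t. (t i, t (i + 1))) \<in> Pi\<^sub>M {1..Suc m} (\<lambda>_. lborel) \<rightarrow>\<^sub>M borel \<Otimes>\<^sub>M borel"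
        using that by (intro measurable_Pair) (auto intro!: measurable_component_singleton[THEN measurable_compose])
      from measurable_compose[OF this assms(1)] show ?thesis
        by simp
    qed
    then show ?thesis
      by (intro borel_measurable_times_ennreal borel_measurable_prod_ennreal)
        (auto intro!: measurable_compose[OF measurable_component_singleton[of 1]])
  qed
  have [measurable]: "F s \<in> borel_measurable borel" for s
    using measurable_compose[OF measurable_Pair1' assms(1), of s] by simp
  have "(\<integral>\<^sup>+ t. indicator {0..1} (t 1) * (\<Prod>i\<in>{1..Suc n}. F (t i) (t (i + 1))) \<partial>Pi\<^sub>M {1..Suc (Suc n)} (\<lambda>_. lborel))
     = (\<integral>\<^sup>+ t. \<integral>\<^sup>+ y. indicator {0..1} ((t(Suc (Suc n) := y)) 1) *
          (\<Prod>i\<in>{1..Suc n}. F ((t(Suc (Suc n) := y)) i) ((t(Suc (Suc n) := y)) (i + 1))) \<partial>lborel \<partial>Pi\<^sub>M {1..Suc n} (\<lambda>_. lborel))"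
    unfolding ins by (rule product_nn_integral_insert) (use meas[of "Suc n"] in \<open>auto simp: ins\<close>)
  also have "\<dots> = (\<integral>\<^sup>+ t. \<integral>\<^sup>+ y. (indicator {0..1} (t 1) * (\<Prod>i\<in>{1..n}. F (t i) (t (i + 1)))) * F (t (Suc n)) y
       \<partial>lborel \<partial>Pi\<^sub>M {1..Suc n} (\<lambda>_. lborel))"
  proof (intro nn_integral_cong)
    fix t :: "nat \<Rightarrow> real" and y :: real
    have "(\<Prod>i\<in>{1..n}. F ((t(Suc (Suc n) := y)) i) ((t(Suc (Suc n) := y)) (i + 1))) = (\<Prod>i\<in>{1..n}. F (t i) (t (i + 1)))"
      by (intro prod.cong) auto
    then show "indicator {0..1} ((t(Suc (Suc n) := y)) 1) *
          (\<Prod>i\<in>{1..Suc n}. F ((t(Suc (Suc n) := y)) i) ((t(Suc (Suc n) := y)) (i + 1))) =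
        (indicator {0..1} (t 1) * (\<Prod>i\<in>{1..n}. F (t i) (t (i + 1)))) * F (t (Suc n)) y"
      by (simp add: mult.assoc mult.commute mult.left_commute)
  qed
  also have "\<dots> = (\<integral>\<^sup>+ t. (indicator {0..1} (t 1) * (\<Prod>i\<in>{1..n}. F (t i) (t (i + 1)))) * (\<integral>\<^sup>+ y. F (t (Suc n)) y \<partial>lborel)
       \<partial>Pi\<^sub>M {1..Suc n} (\<lambda>_. lborel))"
    by (intro nn_integral_cong nn_integral_cmult) simp
  also have "\<dots> \<le> (\<integral>\<^sup>+ t. (indicator {0..1} (t 1) * (\<Prod>i\<in>{1..n}. F (t i) (t (i + 1)))) * B \<partial>Pi\<^sub>M {1..Suc n} (\<lambda>_. lborel))"
    by (intro nn_integral_mono mult_left_mono B) simp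
  also have "\<dots> = (\<integral>\<^sup>+ t. indicator {0..1} (t 1) * (\<Prod>i\<in>{1..n}. F (t i) (t (i + 1))) \<partial>Pi\<^sub>M {1..Suc n} (\<lambda>_. lborel)) * B"
    by (intro nn_integral_multc meas)
  also have "\<dots> \<le> B ^ n * B"
    by (intro mult_right_mono Suc.IH) simp
  finally show ?case
    by (simp add: mult.commute)
qed

section \<open>Curves generated by Volterra kernels\<close>

lemma inner_to_L2:
  assumes "sq_int f" "sq_int h"
  shows "inner (to_L2 f) (to_L2 h) = (\<integral>r. f r * h r \<partial>unit_leb)"
  using assms by (intro inner_L2.abs_eq) (auto simp: L2_rel_def)

lemma norm_to_L2:
  assumes "sq_int f"
  shows "(norm (to_L2 f))\<^sup>2 = (\<integral>r. (f r)\<^sup>2 \<partial>unit_leb)"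
  unfolding power2_norm_eq_inner inner_to_L2[OF assms assms] by (simp add: power2_eq_square)

lemma plus_to_L2:
  assumes "sq_int f" "sq_int h"
  shows "to_L2 f + to_L2 h = to_L2 (\<lambda>r. f r + h r)"
  using assms by (intro plus_L2.abs_eq) (auto simp: L2_rel_def)

lemma L2_representative:
  obtains f where "sq_int f" "h = to_L2 f"
proof -
  have "\<exists>f. sq_int f \<and> h = to_L2 f"
    by (induction h rule: L2.abs_induct) (auto simp: L2_rel_def)
  then show ?thesis
    using that by blast
qed

lemma borel_measurable_unit_leb: "f \<in> borel_measurable borel \<Longrightarrow> f \<in> borel_measurable unit_leb"
  by (intro measurable_restrict_space1 measurable_completion) simp

lemma integrable_unit_leb_bounded:
  fixes f :: "real \<Rightarrow> real"
  assumes "f \<in> borel_measurable unit_leb" "\<And>r. \<bar>f r\<bar> \<le> C"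
  shows "integrable unit_leb f"
  by (rule finite_measure.integrable_const_bound[OF finite_measure_lebesgue_on]) (use assms in auto)

lemma sq_int_bounded:
  assumes "f \<in> borel_measurable borel" "\<And>r. \<bar>f r\<bar> \<le> C"
  shows "sq_int f"
  unfolding sq_int_def
proof
  show f: "f \<in> borel_measurable unit_leb"
    by (rule borel_measurable_unit_leb) fact
  show "integrable unit_leb (\<lambda>r. (f r)\<^sup>2)"
  proof (rule integrable_unit_leb_bounded)
    show "\<bar>(f r)\<^sup>2\<bar> \<le> C\<^sup>2" for r
      using power_mono[OF assms(2)[of r] abs_ge_zero, of 2] by simp
  qed (use f in measurable)
qed

lemma nn_integral_unit_leb:
  "(\<integral>\<^sup>+ r. f r \<partial>unit_leb) = (\<integral>\<^sup>+ r. f r * indicator {0..1} r \<partial>lborel)"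
  by (subst nn_integral_restrict_space) (auto simp: nn_integral_completion)

text \<open>Representatives are only Lebesgue measurable, whereas the joint measurability of
  \<open>hardy_kernel\<close> is stated for Borel \<open>q\<close>. The representative is extended
  by zero, replaced by an almost everywhere equal Borel function, and squared.\<close>

lemma L2_borel_square_density:
  assumes "sq_int f"
  obtains q :: "real \<Rightarrow> ennreal" where "q \<in> borel_measurable borel" "(\<integral>\<^sup>+ r. q r \<partial>lborel) < \<infinity>"
    "AE r in unit_leb. q r = ennreal ((f r)\<^sup>2)"
proof -
  have "(\<lambda>r. if r \<in> {0..1} then f r else 0) \<in> borel_measurable lebesgue"
    using assms by (subst borel_measurable_if) (auto simp: sq_int_def)
  then obtain f' where f' [measurable]: "f' \<in> borel_measurable lborel"
      and ae: "AE r in lborel. (if r \<in> {0..1} then f r else 0) = f' r"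
    using completion_ex_borel_measurable_real by blast
  have "(\<integral>\<^sup>+ r. ennreal ((f' r)\<^sup>2) \<partial>lborel) = (\<integral>\<^sup>+ r. ennreal ((f r)\<^sup>2) * indicator {0..1} r \<partial>lborel)"
  proof (rule nn_integral_cong_AE)
    show "AE r in lborel. ennreal ((f' r)\<^sup>2) = ennreal ((f r)\<^sup>2) * indicator {0..1} r"
      using ae by (rule eventually_mono) (auto simp: indicator_def split: if_splits)
  qed
  also have "\<dots> = (\<integral>\<^sup>+ r. ennreal ((f r)\<^sup>2) \<partial>unit_leb)"
    by (rule nn_integral_unit_leb[symmetric])
  also have "\<dots> < \<infinity>"
    using assms by (auto simp: sq_int_def integrable_iff_bounded)
  finally have 1: "(\<integral>\<^sup>+ r. ennreal ((f' r)\<^sup>2) \<partial>lborel) < \<infinity>" .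
  have "AE r in lebesgue. (if r \<in> {0..1} then f r else 0) = f' r"
    using ae by (rule AE_completion)
  then have "AE r in unit_leb. ennreal ((f' r)\<^sup>2) = ennreal ((f r)\<^sup>2)"
    by (subst AE_restrict_space_iff) (auto elim!: eventually_mono split: if_splits)
  with 1 show ?thesis
    by (intro that[of "\<lambda>r. ennreal ((f' r)\<^sup>2)"]) auto
qed

lemma integral_unit_leb_indicator:
  assumes "0 \<le> s" "s \<le> t" "t \<le> 1"
  shows "(\<integral>r. C * indicator {s<..t} r \<partial>unit_leb) = C * (t - s)"
    and "integrable unit_leb (\<lambda>r. C * indicator {s<..t} r :: real)"
proof -
  show "integrable unit_leb (\<lambda>r. C * indicator {s<..t} r :: real)"
    by (rule integrable_unit_leb_bounded[where C="\<bar>C\<bar>"])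
      (auto simp: indicator_def intro!: borel_measurable_unit_leb)
  have "measure unit_leb {s<..t} = t - s"
    using assms by (subst measure_restrict_space) auto
  moreover have "{s<..t} \<inter> {0..1} = {s<..t}"
    using assms by auto
  ultimately show "(\<integral>r. C * indicator {s<..t} r \<partial>unit_leb) = C * (t - s)"
    by simp
qed

section \<open>Past and innovation of a Volterra curve\<close>

text \<open>Bounds on the whole line avoid side conditions on arguments such as
  \<open>s - r\<close>; a kernel given on [0,1] is brought into this form by clamping its
  argument.\<close>

locale volterra_kernel =
  fixes \<kappa> :: "real \<Rightarrow> real" and M L :: real
  assumes bounded: "\<bar>\<kappa> x\<bar> \<le> M"
    and lipschitz: "\<bar>\<kappa> x - \<kappa> y\<bar> \<le> L * \<bar>x - y\<bar>"
begin

definition curve :: "real \<Rightarrow> L2" where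
  "curve t = to_L2 (\<lambda>r. \<kappa> (t - r) * indicator {0..t} r)"

text \<open>The part of the increment on \<open>{0..s}\<close>, where both curves are active and the
  Lipschitz condition makes the difference small.\<close>

definition past :: "real \<Rightarrow> real \<Rightarrow> L2" where
  "past s t = to_L2 (\<lambda>r. (\<kappa> (t - r) - \<kappa> (s - r)) * indicator {0..s} r)"

text \<open>The part of the increment where every curve up to time \<open>s\<close> vanishes, whence
  its orthogonality to all earlier increments.\<close>

definition innovation :: "real \<Rightarrow> real \<Rightarrow> L2" where
  "innovation s t = to_L2 (\<lambda>r. \<kappa> (t - r) * indicator {s<..t} r)"

lemma M_nonneg: "0 \<le> M"
  using bounded[of 0] by simp

lemma L_nonneg: "0 \<le> L"
  using lipschitz[of 0 1] by simp

lemma continuous_kernel: "continuous_on UNIV \<kappa>"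
proof -
  have "L-lipschitz_on UNIV \<kappa>"
    using lipschitz L_nonneg by (auto simp: lipschitz_on_def dist_real_def)
  then show ?thesis
    by (rule lipschitz_on_continuous_on)
qed

lemma measurable_kernel [measurable]: "\<kappa> \<in> borel_measurable borel"
  using continuous_kernel by (rule borel_measurable_continuous_onI)

lemma sq_int_curve: "sq_int (\<lambda>r. \<kappa> (t - r) * indicator {0..t} r)"
  by (rule sq_int_bounded[where C=M]) (auto simp: indicator_def bounded M_nonneg)

lemma sq_int_innovation: "sq_int (\<lambda>r. \<kappa> (t - r) * indicator {s<..t} r)"
  by (rule sq_int_bounded[where C=M]) (auto simp: indicator_def bounded M_nonneg)

lemma past_bound: "\<bar>(\<kappa> (t - r) - \<kappa> (s - r)) * indicator {0..s} r\<bar> \<le> L * \<bar>t - s\<bar>"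
  using lipschitz[of "t - r" "s - r"] L_nonneg by (auto simp: indicator_def)

lemma sq_int_past: "sq_int (\<lambda>r. (\<kappa> (t - r) - \<kappa> (s - r)) * indicator {0..s} r)"
  by (rule sq_int_bounded[OF _ past_bound]) measurable

lemma curve_split:
  assumes "0 \<le> s" "s \<le> t"
  shows "curve t - curve s = past s t + innovation s t"
proof -
  have "curve s + (past s t + innovation s t) = to_L2 (\<lambda>r. \<kappa> (s - r) * indicator {0..s} r +
      ((\<kappa> (t - r) - \<kappa> (s - r)) * indicator {0..s} r + \<kappa> (t - r) * indicator {s<..t} r))"
    unfolding curve_def past_def innovation_def
    by (simp only: plus_to_L2 sq_int_past sq_int_innovation sq_int_curve sq_int_add)
  also have "\<dots> = curve t"
    unfolding curve_def
    by (rule arg_cong[where f=to_L2]) (use assms in \<open>auto simp: fun_eq_iff indicator_def\<close>)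
  finally have "curve s + (past s t + innovation s t) = curve t" .
  then show ?thesis
    by (simp add: algebra_simps)
qed

lemma inner_innovation_past: "inner (innovation s t) (past s t) = 0"
proof -
  have "(\<lambda>r. \<kappa> (t - r) * indicator {s<..t} r * ((\<kappa> (t - r) - \<kappa> (s - r)) * indicator {0..s} r)) = (\<lambda>r. 0)"
    by (auto simp: indicator_def)
  then show ?thesis
    unfolding innovation_def past_def by (simp add: inner_to_L2 sq_int_past sq_int_innovation)
qed

lemma inner_innovation_curve:
  assumes "u \<le> s"
  shows "inner (innovation s t) (curve u) = 0"
proof -
  have "(\<lambda>r. \<kappa> (t - r) * indicator {s<..t} r * (\<kappa> (u - r) * indicator {0..u} r)) = (\<lambda>r. 0)"
    using assms by (auto simp: indicator_def)
  then show ?thesis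
    unfolding innovation_def curve_def by (simp add: inner_to_L2 sq_int_curve sq_int_innovation)
qed

text \<open>The Lipschitz bound holds pointwise and [0,1] has measure \<open>1\<close>. The squared
  norm is quadratic in \<open>t - s\<close>, against linear growth for the innovation.\<close>

lemma norm_past_le:
  assumes "s \<le> t"
  shows "(norm (past s t))\<^sup>2 \<le> L\<^sup>2 * (t - s)\<^sup>2"
proof -
  have "(norm (past s t))\<^sup>2 = (\<integral>r. ((\<kappa> (t - r) - \<kappa> (s - r)) * indicator {0..s} r)\<^sup>2 \<partial>unit_leb)"
    unfolding past_def by (rule norm_to_L2[OF sq_int_past])
  also have "\<dots> \<le> (\<integral>r. L\<^sup>2 * (t - s)\<^sup>2 \<partial>unit_leb)"
  proof (rule integral_mono)
    show "((\<kappa> (t - r) - \<kappa> (s - r)) * indicator {0..s} r)\<^sup>2 \<le> L\<^sup>2 * (t - s)\<^sup>2" for r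
      using power_mono[OF past_bound[of t r s] abs_ge_zero, of 2] by (simp add: power_mult_distrib)
  qed (use sq_int_past[of t s] in \<open>auto simp: sq_int_def intro: integrable_unit_leb_bounded\<close>)
  also have "\<dots> = L\<^sup>2 * (t - s)\<^sup>2"
    by (simp add: measure_restrict_space)
  finally show ?thesis .
qed

lemma norm_innovation_eq:
  "(norm (innovation s t))\<^sup>2 = (\<integral>r. (\<kappa> (t - r))\<^sup>2 * indicator {s<..t} r \<partial>unit_leb)"
  unfolding innovation_def by (subst norm_to_L2[OF sq_int_innovation])
    (auto simp: indicator_def intro!: Bochner_Integration.integral_cong)

lemma integrable_innovation: "integrable unit_leb (\<lambda>r. (\<kappa> (t - r))\<^sup>2 * indicator {s<..t} r)"
proof -
  have "(\<lambda>r. (\<kappa> (t - r))\<^sup>2 * indicator {s<..t} r) = (\<lambda>r. (\<kappa> (t - r) * indicator {s<..t} r)\<^sup>2)"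
    by (auto simp: indicator_def)
  then show ?thesis
    using sq_int_innovation[of t s] by (simp add: sq_int_def)
qed

lemma norm_innovation_le:
  assumes "0 \<le> s" "s \<le> t" "t \<le> 1"
  shows "(norm (innovation s t))\<^sup>2 \<le> M\<^sup>2 * (t - s)"
proof -
  have "(\<kappa> x)\<^sup>2 \<le> M\<^sup>2" for x
    using power_mono[OF bounded[of x] abs_ge_zero, of 2] by simp
  then have "(\<integral>r. (\<kappa> (t - r))\<^sup>2 * indicator {s<..t} r \<partial>unit_leb) \<le> (\<integral>r. M\<^sup>2 * indicator {s<..t} r \<partial>unit_leb)"
    by (intro integral_mono integrable_innovation integral_unit_leb_indicator assms) (auto simp: indicator_def)
  then show ?thesis
    by (simp only: norm_innovation_eq integral_unit_leb_indicator[OF assms])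
qed

text \<open>By the Lipschitz condition the kernel stays above half of its absolute value at
  \<open>0\<close> on some \<open>{0..\<delta>}\<close>, and the last piece of
  \<open>{s<..t}\<close> sees only these arguments.\<close>

lemma norm_innovation_ge:
  assumes "\<kappa> 0 \<noteq> 0"
  obtains c where "c > 0"
    "\<And>s t. 0 \<le> s \<Longrightarrow> s \<le> t \<Longrightarrow> t \<le> 1 \<Longrightarrow> c * (t - s) \<le> (norm (innovation s t))\<^sup>2"
proof -
  \<comment> \<open>The choice gives \<open>L * \<delta> \<le> \<bar>\<kappa> 0\<bar> / 2\<close>
    and \<open>\<delta> \<le> 1\<close>; the summand \<open>\<bar>\<kappa> 0\<bar>\<close> keeps the
    denominator positive when \<open>L = 0\<close>.\<close>
  define \<delta> where "\<delta> = \<bar>\<kappa> 0\<bar> / (2 * (L + \<bar>\<kappa> 0\<bar>))"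
  have \<delta>: "0 < \<delta>" "\<delta> \<le> 1"
    using assms L_nonneg by (auto simp: \<delta>_def field_simps)
  have low: "(\<kappa> 0)\<^sup>2 / 4 \<le> (\<kappa> x)\<^sup>2" if "0 \<le> x" "x \<le> \<delta>" for x
  proof -
    have "L * \<delta> \<le> \<bar>\<kappa> 0\<bar> / 2"
      using assms L_nonneg by (simp add: \<delta>_def field_simps)
    moreover have "L * x \<le> L * \<delta>"
      using that L_nonneg by (intro mult_left_mono)
    ultimately have "\<bar>\<kappa> 0\<bar> / 2 \<le> \<bar>\<kappa> x\<bar>"
      using lipschitz[of 0 x] that by simp
    from power_mono[OF this, of 2] show ?thesis
      by (simp add: power_divide)
  qed
  have "(\<kappa> 0)\<^sup>2 / 4 * \<delta> * (t - s) \<le> (norm (innovation s t))\<^sup>2" if st: "0 \<le> s" "s \<le> t" "t \<le> 1" for s t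
  proof -
    define u where "u = max s (t - \<delta>)"
    have u: "0 \<le> u" "u \<le> t" "s \<le> u" "t - \<delta> \<le> u"
      using st \<delta> by (auto simp: u_def)
    \<comment> \<open>The interval from \<open>u\<close> to \<open>t\<close> has length the minimum
      of \<open>t - s\<close> and \<open>\<delta>\<close>, and both of these numbers are at most
      \<open>1\<close>.\<close>
    have "\<delta> * (t - s) \<le> 1 * (t - s)" "\<delta> * (t - s) \<le> \<delta> * 1"
      using st \<delta> by (auto intro!: mult_left_le_one_le)
    then have "\<delta> * (t - s) \<le> t - u"
      by (auto simp: u_def max_def)
    then have "(\<kappa> 0)\<^sup>2 / 4 * (\<delta> * (t - s)) \<le> (\<kappa> 0)\<^sup>2 / 4 * (t - u)"
      by (rule mult_left_mono) simp
    also have "\<dots> = (\<integral>r. (\<kappa> 0)\<^sup>2 / 4 * indicator {u<..t} r \<partial>unit_leb)"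
      using u st by (intro integral_unit_leb_indicator(1)[symmetric])
    also have "\<dots> \<le> (\<integral>r. (\<kappa> (t - r))\<^sup>2 * indicator {s<..t} r \<partial>unit_leb)"
      using u st low
      by (intro integral_mono integrable_innovation integral_unit_leb_indicator) (auto simp: indicator_def)
    finally show ?thesis
      by (simp add: norm_innovation_eq mult.assoc)
  qed
  then show ?thesis
    using \<delta> assms by (intro that[of "(\<kappa> 0)\<^sup>2 / 4 * \<delta>"]) auto
qed

text \<open>The past is of order \<open>t - s\<close> and the innovation of order
  \<open>sqrt (t - s)\<close>. Continuity later yields Borel measurability of the integrand.\<close>

lemma continuous_curve: "continuous_on {0..1} curve"
proof -
  have *: "norm (curve t - curve s) \<le> L * (t - s) + M * sqrt (t - s)"
    if "0 \<le> s" "s \<le> t" "t \<le> 1" for s t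
  proof -
    have "norm (past s t) \<le> L * (t - s)"
      using norm_past_le[OF that(2)] that L_nonneg
      by - (rule power2_le_imp_le, auto simp: power_mult_distrib)
    moreover have "norm (innovation s t) \<le> M * sqrt (t - s)"
      using norm_innovation_le[OF that] that M_nonneg
      by - (rule power2_le_imp_le, auto simp: power_mult_distrib)
    ultimately show ?thesis
      unfolding curve_split[OF that(1,2)] by (intro norm_triangle_mono)
  qed
  have bound: "norm (curve t - curve s) \<le> L * \<bar>t - s\<bar> + M * sqrt \<bar>t - s\<bar>"
    if "s \<in> {0..1}" "t \<in> {0..1}" for s t
    using that *[of s t] *[of t s] by (cases "s \<le> t") (auto simp: norm_minus_commute)
  have "((\<lambda>t. curve t - curve s) \<longlongrightarrow> 0) (at s within {0..1})" if s: "s \<in> {0..1}" for s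
  proof (rule Lim_null_comparison)
    show "\<forall>\<^sub>F t in at s within {0..1}. norm (curve t - curve s) \<le> L * \<bar>t - s\<bar> + M * sqrt \<bar>t - s\<bar>"
      using bound[OF s] by (auto simp: eventually_at_filter)
    have "((\<lambda>t. L * \<bar>t - s\<bar> + M * sqrt \<bar>t - s\<bar>) \<longlongrightarrow> L * \<bar>s - s\<bar> + M * sqrt \<bar>s - s\<bar>) (at s within {0..1})"
      by (intro tendsto_intros)
    then show "((\<lambda>t. L * \<bar>t - s\<bar> + M * sqrt \<bar>t - s\<bar>) \<longlongrightarrow> 0) (at s within {0..1})"
      by simp
  qed
  then show ?thesis
    unfolding continuous_on_def by (blast intro: LIM_zero_cancel)
qed

text \<open>Cauchy--Schwarz with the weight \<open>(r - s) powr (1 / 4)\<close> moved from one factor to the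
  other, as in a standard proof of Hardy's inequality.\<close>

lemma inner_innovation_hardy:
  obtains q where "q \<in> borel_measurable borel" "(\<integral>\<^sup>+ r. q r \<partial>lborel) < \<infinity>"
    "\<And>s t. 0 \<le> s \<Longrightarrow> s < t \<Longrightarrow> t \<le> 1 \<Longrightarrow>
      ennreal ((inner h (innovation s t))\<^sup>2) \<le> ennreal (2 * M\<^sup>2 * (t - s)\<^sup>2) * hardy_kernel q s t"
proof -
  obtain f where f: "sq_int f" "h = to_L2 f"
    by (rule L2_representative)
  have [measurable]: "f \<in> borel_measurable unit_leb"
    using f by (simp add: sq_int_def)
  obtain q where q: "q \<in> borel_measurable borel" "(\<integral>\<^sup>+ r. q r \<partial>lborel) < \<infinity>"
     and ae: "AE r in unit_leb. q r = ennreal ((f r)\<^sup>2)"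
    using L2_borel_square_density[OF f(1)] by blast
  show ?thesis
  proof (rule that[OF q])
    fix s t :: real assume st: "0 \<le> s" "s < t" "t \<le> 1"
    \<comment> \<open>The weight is the fourth root of \<open>r - s\<close>. It is positive on the
      support of \<open>u\<close> and \<open>v\<close>, so it cancels in their product.\<close>
    define w where "w r = sqrt (sqrt (r - s))" for r
    define u where "u r = ennreal (\<bar>f r\<bar> * w r * indicator {s<..t} r)" for r
    define v where "v r = ennreal (M / w r * indicator {s<..t} r)" for r
    have [measurable]: "w \<in> borel_measurable unit_leb"
      unfolding w_def by (rule borel_measurable_unit_leb) measurable
    have [measurable]: "(indicator {s<..t} :: real \<Rightarrow> real) \<in> borel_measurable unit_leb"
      by (rule borel_measurable_unit_leb) measurable
    have [measurable]: "u \<in> borel_measurable unit_leb" "v \<in> borel_measurable unit_leb"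
      unfolding u_def v_def by measurable
    have "ennreal \<bar>inner h (innovation s t)\<bar> \<le> (\<integral>\<^sup>+ r. norm (f r * (\<kappa> (t - r) * indicator {s<..t} r)) \<partial>unit_leb)"
      unfolding f innovation_def inner_to_L2[OF f(1) sq_int_innovation] real_norm_def[symmetric]
      by (rule integral_norm_bound_ennreal) (rule sq_int_mult[OF f(1) sq_int_innovation])
    also have "\<dots> \<le> (\<integral>\<^sup>+ r. u r * v r \<partial>unit_leb)"
    proof (rule nn_integral_mono)
      fix r
      have "norm (f r * (\<kappa> (t - r) * indicator {s<..t} r)) \<le> (\<bar>f r\<bar> * w r * indicator {s<..t} r) * (M / w r * indicator {s<..t} r)"
        using bounded[of "t - r"] by (auto simp: indicator_def w_def abs_mult intro!: mult_left_mono)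
      moreover have "w r \<ge> 0" if "r > s"
        using that by (simp add: w_def)
      ultimately show "ennreal (norm (f r * (\<kappa> (t - r) * indicator {s<..t} r))) \<le> u r * v r"
        unfolding u_def v_def using M_nonneg
        by (subst ennreal_mult[symmetric]) (auto simp: indicator_def intro!: ennreal_leI)
    qed
    finally have "(ennreal \<bar>inner h (innovation s t)\<bar>)\<^sup>2 \<le> (\<integral>\<^sup>+ r. u r * v r \<partial>unit_leb)\<^sup>2"
      by (intro power_mono) auto
    also have "\<dots> \<le> (\<integral>\<^sup>+ r. (u r)\<^sup>2 \<partial>unit_leb) * (\<integral>\<^sup>+ r. (v r)\<^sup>2 \<partial>unit_leb)"
      by (rule Cauchy_Schwarz_nn_integral) measurable
    \<comment> \<open>Squaring turns \<open>w\<close> into \<open>sqrt (r - s)\<close>: the first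
      integral takes the form used in \<open>hardy_kernel\<close>, the second is an integral of
      \<open>M^2 / sqrt (r - s)\<close>.\<close>
    also have "\<dots> \<le> (\<integral>\<^sup>+ r. q r * ennreal (sqrt (r - s)) * indicator {s<..t} r \<partial>lborel) * ennreal (M\<^sup>2 * (2 * sqrt (t - s)))"
    proof (rule mult_mono)
      have "(\<integral>\<^sup>+ r. (u r)\<^sup>2 \<partial>unit_leb) = (\<integral>\<^sup>+ r. q r * ennreal (sqrt (r - s)) * indicator {s<..t} r \<partial>unit_leb)"
      proof (rule nn_integral_cong_AE)
        show "AE r in unit_leb. (u r)\<^sup>2 = q r * ennreal (sqrt (r - s)) * indicator {s<..t} r"
          using ae
        proof (rule eventually_mono)
          fix r assume r: "q r = ennreal ((f r)\<^sup>2)"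
          show "(u r)\<^sup>2 = q r * ennreal (sqrt (r - s)) * indicator {s<..t} r"
            unfolding u_def r w_def
            by (auto simp: indicator_def ennreal_power power_mult_distrib ennreal_mult')
        qed
      qed
      also have "\<dots> \<le> (\<integral>\<^sup>+ r. q r * ennreal (sqrt (r - s)) * indicator {s<..t} r \<partial>lborel)"
        unfolding nn_integral_unit_leb by (intro nn_integral_mono) (auto simp: indicator_def)
      finally show "(\<integral>\<^sup>+ r. (u r)\<^sup>2 \<partial>unit_leb) \<le> \<dots>" .
      have "(\<integral>\<^sup>+ r. (v r)\<^sup>2 \<partial>unit_leb) \<le> (\<integral>\<^sup>+ r. ennreal (M\<^sup>2) * (ennreal (1 / sqrt (r - s)) * indicator {s..t} r) \<partial>lborel)"
        unfolding nn_integral_unit_leb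
      proof (rule nn_integral_mono)
        fix r
        show "(v r)\<^sup>2 * indicator {0..1} r \<le> ennreal (M\<^sup>2) * (ennreal (1 / sqrt (r - s)) * indicator {s..t} r)"
          using M_nonneg unfolding v_def w_def
          by (auto simp: indicator_def ennreal_power power_divide ennreal_mult'[symmetric])
      qed
      also have "\<dots> = ennreal (M\<^sup>2 * (2 * sqrt (t - s)))"
        using st by (subst nn_integral_cmult) (auto simp: nn_integral_inverse_sqrt ennreal_mult')
      finally show "(\<integral>\<^sup>+ r. (v r)\<^sup>2 \<partial>unit_leb) \<le> \<dots>" .
    qed auto
    also have "\<dots> = ennreal (2 * M\<^sup>2 * (t - s)\<^sup>2) * hardy_kernel q s t"
    proof -
      have "sqrt (t - s) * sqrt (t - s) = t - s"
        using st by simp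
      \<comment> \<open>The power 1/2 of \<open>t - s\<close> is split as 2 - 3/2 to expose the
        prefactor of \<open>hardy_kernel\<close>.\<close>
      then have "M\<^sup>2 * (2 * sqrt (t - s)) = 2 * M\<^sup>2 * (t - s)\<^sup>2 * (1 / ((t - s) * sqrt (t - s)))"
        using st by (simp add: field_simps power2_eq_square)
      then have "ennreal (M\<^sup>2 * (2 * sqrt (t - s))) = ennreal (2 * M\<^sup>2 * (t - s)\<^sup>2) * ennreal (1 / ((t - s) * sqrt (t - s)))"
        using st by (simp add: ennreal_mult'[symmetric])
      then show ?thesis
        unfolding hardy_kernel_def by (simp add: mult_ac)
    qed
    finally show "ennreal ((inner h (innovation s t))\<^sup>2) \<le> ennreal (2 * M\<^sup>2 * (t - s)\<^sup>2) * hardy_kernel q s t"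
      by (simp add: ennreal_power)
  qed
qed

end

section \<open>Integrability of the renormalized integrand\<close>

text \<open>Strong induction along the Gram--Schmidt recursion, tested through real-valued inner
  products. The vector \<open>v\<close> may depend on \<open>t\<close> because the recursion also
  pairs earlier orthogonalised increments with increments.\<close>

lemma measurable_inner_orth_incr:
  fixes g :: "real \<Rightarrow> L2"
  assumes g: "\<And>a b. a \<in> I \<Longrightarrow> b \<in> I \<Longrightarrow> (\<lambda>t. inner (g (t a)) (g (t b))) \<in> borel_measurable N"
    and v: "\<And>a. a \<in> I \<Longrightarrow> (\<lambda>t. inner (g (t a)) (v t)) \<in> borel_measurable N"
    and i: "{1..i + 1} \<subseteq> I" "i \<ge> 1"
  shows "(\<lambda>t. inner (orth_incr g t i) (v t)) \<in> borel_measurable N"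
  using i v
proof (induction i arbitrary: v rule: less_induct)
  case (less i)
  have incr_v: "(\<lambda>t. inner (incr g t j) (w t)) \<in> borel_measurable N"
    if "\<And>a. a \<in> I \<Longrightarrow> (\<lambda>t. inner (g (t a)) (w t)) \<in> borel_measurable N" "1 \<le> j" "j \<le> i" for w j
  proof -
    have "j \<in> I" "j + 1 \<in> I"
      using that less.prems by auto
    then show ?thesis
      unfolding incr_def inner_diff_left by (intro borel_measurable_diff that(1))
  qed
  have incr_e: "(\<lambda>t. inner (orth_incr g t j) (incr g t l)) \<in> borel_measurable N"
    if "1 \<le> j" "j < i" "1 \<le> l" "l \<le> i" for j l
  proof (rule less.IH)
    fix a assume "a \<in> I"
    then show "(\<lambda>t. inner (g (t a)) (incr g t l)) \<in> borel_measurable N"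
      using that less.prems(1)
      by (auto simp: incr_def inner_diff_right intro!: borel_measurable_diff g)
  qed (use that less.prems in auto)
  \<comment> \<open>Denominators are rewritten by \<open>inner_orth_incr_self\<close>, so every
    orthogonalised increment is paired with an increment or with \<open>v t\<close>.\<close>
  have "(\<lambda>t. inner (orth_incr g t i) (v t)) = (\<lambda>t. inner (incr g t i) (v t) -
      (\<Sum>j\<in>{1..<i}. inner (orth_incr g t j) (incr g t i) / inner (orth_incr g t j) (incr g t j)
          * inner (orth_incr g t j) (v t)))"
    by (subst orth_incr_eq_sum)
      (simp add: inner_diff_left inner_sum_left inner_orth_incr_self inner_commute[of "incr g _ i"] del: One_nat_def)
  also have "\<dots> \<in> borel_measurable N"
    using less.prems
    by (intro borel_measurable_diff borel_measurable_sum borel_measurable_times borel_measurable_divide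
        incr_v incr_e less.IH) auto
  finally show ?case .
qed

lemma orth_incr_cong:
  assumes "\<And>j. j \<in> {1..i + 1} \<Longrightarrow> g (t j) = g' (t j)" "1 \<le> i"
  shows "orth_incr g t i = orth_incr g' t i"
proof -
  have "incr g t j = incr g' t j" if "j \<in> {1..i}" for j
    using that assms by (simp add: incr_def)
  then have "incr g t i = incr g' t i" "incr g t ` {1..<i} = incr g' t ` {1..<i}"
    using assms(2) by (auto intro!: image_cong)
  then show ?thesis
    by (simp add: orth_incr_def)
qed

lemma orth_incr_eq_0:
  assumes "t (i + 1) = t i"
  shows "orth_incr g t i = 0"
  using inner_orth_incr_self[of g t i] assms by (simp add: incr_def)

lemma rosen_integrand_cong:
  assumes "\<And>j. j \<in> {1..k} \<Longrightarrow> g (t j) = g' (t j)"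
  shows "rosen_integrand g k h1 h2 t = rosen_integrand g' k h1 h2 t"
proof -
  have "orth_incr g t i = orth_incr g' t i" if "i \<in> {1..k - 1}" for i
    using that by (intro orth_incr_cong assms) auto
  then show ?thesis
    unfolding rosen_integrand_def by (intro prod.cong) auto
qed

lemma rosen_integrand_eq:
  "rosen_integrand g k h1 h2 t = (\<Prod>i = 1..k - 1. 1 / (norm (orth_incr g t i))\<^sup>2 *
     (exp (- (1 / 2) * ((inner h1 (orth_incr g t i))\<^sup>2 / (norm (orth_incr g t i))\<^sup>2
        + (inner h2 (orth_incr g t i))\<^sup>2 / (norm (orth_incr g t i))\<^sup>2)) - 1))"
  unfolding rosen_integrand_def norm_orth_proj_span_singleton ..

text \<open>The integrand is built from Gram matrix entries \<open>inner (g (t a)) (g (t b))\<close>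
  and pairings with \<open>h1\<close> and \<open>h2\<close>, all continuous in the times.\<close>

lemma borel_measurable_rosen_integrand:
  fixes g :: "real \<Rightarrow> L2"
  assumes "continuous_on UNIV g"
  shows "rosen_integrand g k h1 h2 \<in> borel_measurable (Pi\<^sub>M {1..k} (\<lambda>_. lborel))" (is "_ \<in> borel_measurable ?N")
proof -
  have comp: "(\<lambda>t. t a) \<in> borel_measurable ?N" if "a \<in> {1..k}" for a
    using measurable_component_singleton[OF that, of "\<lambda>_. lborel"] by simp
  have const: "(\<lambda>t. inner (g (t a)) h) \<in> borel_measurable ?N" if "a \<in> {1..k}" for a h
  proof -
    have "(\<lambda>x. inner (g x) h) \<in> borel_measurable borel"
      using assms by (intro borel_measurable_continuous_onI continuous_intros)
    from measurable_compose[OF comp[OF that] this] show ?thesis .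
  qed
  have gg: "(\<lambda>t. inner (g (t a)) (g (t b))) \<in> borel_measurable ?N" if "a \<in> {1..k}" "b \<in> {1..k}" for a b
  proof -
    have "continuous_on UNIV (\<lambda>p. inner (g (fst p)) (g (snd p)))"
      by (intro continuous_intros continuous_on_compose2[OF assms]) auto
    then have "(\<lambda>p. inner (g (fst p)) (g (snd p))) \<in> borel_measurable (borel \<Otimes>\<^sub>M borel)"
      unfolding borel_prod by (rule borel_measurable_continuous_onI)
    from measurable_compose[OF measurable_Pair[OF comp comp] this] that show ?thesis
      by simp
  qed
  have "(\<lambda>t. inner h (orth_incr g t i)) \<in> borel_measurable ?N" if "i \<in> {1..k - 1}" for i h
    unfolding inner_commute[of h]
    by (rule measurable_inner_orth_incr[where I="{1..k}"]) (use that gg const in auto)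
  moreover have "(\<lambda>t. norm (orth_incr g t i)) \<in> borel_measurable ?N" if "i \<in> {1..k - 1}" for i
    unfolding norm_eq_sqrt_inner inner_orth_incr_self
    by (rule measurable_compose[OF _ borel_measurable_sqrt], rule measurable_inner_orth_incr[where I="{1..k}"])
      (use that in \<open>auto simp: incr_def inner_diff_right simp del: One_nat_def intro!: gg borel_measurable_diff\<close>)
  ultimately show ?thesis
    unfolding rosen_integrand_eq
    by (intro borel_measurable_prod borel_measurable_times borel_measurable_divide borel_measurable_diff
        borel_measurable_exp borel_measurable_power borel_measurable_add borel_measurable_const
        measurable_compose[OF _ borel_measurable_exp]) auto
qed

lemma sets_time_simplex: "time_simplex k \<in> sets (Pi\<^sub>M {1..k} (\<lambda>_. lborel))" (is "_ \<in> sets ?N")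
proof -
  have "time_simplex k = {t \<in> space ?N. \<forall>i\<in>{1..k}. \<forall>j\<in>{1..k}. 0 \<le> t i \<and> t i \<le> 1 \<and> (i \<le> j \<longrightarrow> t i \<le> t j)}"
    by (auto simp: time_simplex_def space_PiM PiE_iff mono_on_def)
  also have "\<dots> \<in> sets ?N"
  proof (intro sets.sets_Collect_finite_All)
    fix i j assume "i \<in> {1..k}" "j \<in> {1..k}"
    then have "(\<lambda>t. t i) \<in> borel_measurable ?N" "(\<lambda>t. t j) \<in> borel_measurable ?N"
      using measurable_component_singleton[of _ "{1..k}" "\<lambda>_. lborel"] by simp_all
    then show "{t \<in> space ?N. 0 \<le> t i \<and> t i \<le> 1 \<and> (i \<le> j \<longrightarrow> t i \<le> t j)} \<in> sets ?N"
      by (intro sets.sets_Collect_conj sets.sets_Collect_imp sets.sets_Collect_const borel_measurable_le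
          borel_measurable_const)
  qed auto
  finally show ?thesis .
qed

section \<open>Pointwise bound on the integrand\<close>

text \<open>The exponential difference is at most its exponent in absolute value. The projections
  contribute a second \<open>1 / N\<close>, which explains the square of the lower bound
  \<open>n\<close>.\<close>

lemma abs_rosen_factor_le:
  fixes N D1 D2 n :: real
  assumes "0 < n" "n \<le> N" "0 \<le> D1" "0 \<le> D2"
  shows "\<bar>1 / N * (exp (- (1 / 2) * (D1 / N + D2 / N)) - 1)\<bar> \<le> (D1 + D2) / (2 * n\<^sup>2)"
proof -
  define x where "x = (D1 / N + D2 / N) / 2"
  have "N > 0" "x \<ge> 0"
    using assms by (auto simp: x_def)
  have "1 - exp (- x) \<le> x"
    using exp_ge_add_one_self[of "- x"] by simp
  then have "\<bar>1 / N * (exp (- x) - 1)\<bar> \<le> 1 / N * x"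
    using \<open>N > 0\<close> \<open>x \<ge> 0\<close> by (simp add: abs_mult divide_right_mono)
  also have "\<dots> = (D1 + D2) / (2 * N\<^sup>2)"
    by (simp add: x_def power2_eq_square flip: add_divide_distrib)
  also have "\<dots> \<le> (D1 + D2) / (2 * n\<^sup>2)"
    using assms by (intro divide_left_mono mult_left_mono power_mono mult_pos_pos) auto
  finally show ?thesis
    by (simp add: x_def)
qed

context volterra_kernel
begin

lemma rosen_factor_le:
  assumes t: "\<And>j. 1 \<le> j \<Longrightarrow> j \<le> i \<Longrightarrow> 0 \<le> t j \<and> t j \<le> t i" and i: "1 \<le> i"
    and lt: "t i < t (i + 1)" "t (i + 1) \<le> 1"
    and c: "c > 0" "c * (t (i + 1) - t i) \<le> (norm (innovation (t i) (t (i + 1))))\<^sup>2"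
    and \<gamma>: "\<And>u. u \<in> {0..1} \<Longrightarrow> \<gamma> u = curve u"
  defines "e \<equiv> orth_incr \<gamma> t i" and "b \<equiv> innovation (t i) (t (i + 1))"
  shows "\<bar>1 / (norm e)\<^sup>2 * (exp (- (1 / 2) * ((inner h1 e)\<^sup>2 / (norm e)\<^sup>2 + (inner h2 e)\<^sup>2 / (norm e)\<^sup>2)) - 1)\<bar>
    \<le> ((inner h1 b)\<^sup>2 + (inner h2 b)\<^sup>2) / (c\<^sup>2 * (t (i + 1) - t i)\<^sup>2) + L\<^sup>2 * ((norm h1)\<^sup>2 + (norm h2)\<^sup>2) / c\<^sup>2"
proof -
  define \<tau> where "\<tau> = t (i + 1) - t i"
  define a where "a = past (t i) (t (i + 1))"
  have \<tau>: "\<tau> > 0"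
    using lt by (simp add: \<tau>_def)
  have \<gamma>t: "\<gamma> (t j) = curve (t j)" if "1 \<le> j" "j \<le> i + 1" for j
    using t[of j] t[of i] i lt that by (intro \<gamma>) (cases "j = i + 1", auto)
  have inc: "incr \<gamma> t i = a + b"
    unfolding incr_def a_def b_def using i lt t[of i] by (simp add: \<gamma>t curve_split)
  have ba: "inner b a = 0"
    by (simp add: a_def b_def inner_innovation_past)
  have orth: "inner b (incr \<gamma> t j) = 0" if "j \<in> {1..<i}" for j
    using that t[of j] t[of "Suc j"]
    by (simp add: incr_def \<gamma>t inner_diff_right b_def inner_innovation_curve)
  have a: "(norm a)\<^sup>2 \<le> L\<^sup>2 * \<tau>\<^sup>2"
    unfolding a_def \<tau>_def using lt by (intro norm_past_le) simp
  have D: "(inner h e)\<^sup>2 \<le> 2 * (inner h b)\<^sup>2 + 2 * (norm h)\<^sup>2 * (L\<^sup>2 * \<tau>\<^sup>2)" for h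
    using inner_orth_incr_le[OF inc ba orth, of h] mult_left_mono[OF a, of "2 * (norm h)\<^sup>2"]
    by (simp add: e_def)
  have "\<bar>1 / (norm e)\<^sup>2 * (exp (- (1 / 2) * ((inner h1 e)\<^sup>2 / (norm e)\<^sup>2 + (inner h2 e)\<^sup>2 / (norm e)\<^sup>2)) - 1)\<bar>
      \<le> ((inner h1 e)\<^sup>2 + (inner h2 e)\<^sup>2) / (2 * (c * \<tau>)\<^sup>2)"
  proof (rule abs_rosen_factor_le)
    show "c * \<tau> \<le> (norm e)\<^sup>2"
      using c(2) norm_orth_incr_ge[OF inc ba orth] unfolding e_def b_def \<tau>_def by (rule order_trans)
  qed (use c \<tau> in auto)
  also have "\<dots> \<le> (2 * (inner h1 b)\<^sup>2 + 2 * (norm h1)\<^sup>2 * (L\<^sup>2 * \<tau>\<^sup>2) + (2 * (inner h2 b)\<^sup>2 + 2 * (norm h2)\<^sup>2 * (L\<^sup>2 * \<tau>\<^sup>2)))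
       / (2 * (c * \<tau>)\<^sup>2)"
    by (intro divide_right_mono add_mono D) simp
  \<comment> \<open>In the past terms \<open>\<tau>^2\<close> cancels against the denominator, so
    only the innovation terms remain singular.\<close>
  also have "\<dots> = ((inner h1 b)\<^sup>2 + (inner h2 b)\<^sup>2) / (c\<^sup>2 * \<tau>\<^sup>2) + L\<^sup>2 * ((norm h1)\<^sup>2 + (norm h2)\<^sup>2) / c\<^sup>2"
    using c \<tau> by (simp add: field_simps)
  finally show ?thesis
    by (simp add: \<tau>_def)
qed

lemma rosen_local_time_exists_curve:
  assumes "\<kappa> 0 \<noteq> 0" "k \<ge> 1" and \<gamma>: "\<And>u. u \<in> {0..1} \<Longrightarrow> \<gamma> u = curve u"
  shows "rosen_local_time_exists \<gamma> k"
  unfolding rosen_local_time_exists_def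
proof (intro allI)
  fix h1 h2 :: L2
  let ?N = "Pi\<^sub>M {1..k} (\<lambda>_. lborel :: real measure)"
  \<comment> \<open>Only the values of \<open>\<gamma>\<close> on [0,1] are prescribed;
    measurability is proved for this continuous extension, which gives the same integrand on the
    simplex.\<close>
  define \<gamma>' where "\<gamma>' x = curve (max 0 (min 1 x))" for x
  have \<gamma>': "\<gamma>' u = curve u" if "u \<in> {0..1}" for u
    using that by (simp add: \<gamma>'_def)
  have "continuous_on UNIV \<gamma>'"
    unfolding \<gamma>'_def by (intro continuous_on_compose2[OF continuous_curve] continuous_intros) auto
  then have meas [measurable]: "rosen_integrand \<gamma>' k h1 h2 \<in> borel_measurable ?N"
    by (rule borel_measurable_rosen_integrand)
  have [measurable]: "time_simplex k \<in> sets ?N"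
    by (rule sets_time_simplex)
  have simplex: "0 \<le> t i \<and> t i \<le> 1" "i \<le> j \<Longrightarrow> j \<le> k \<Longrightarrow> t i \<le> t j"
    if "t \<in> time_simplex k" "1 \<le> i" "i \<le> k" for t i j
    using that by (auto simp: time_simplex_def PiE_iff mono_on_def)
  obtain c where c: "c > 0"
    "\<And>s t. 0 \<le> s \<Longrightarrow> s \<le> t \<Longrightarrow> t \<le> 1 \<Longrightarrow> c * (t - s) \<le> (norm (innovation s t))\<^sup>2"
    using norm_innovation_ge[OF assms(1)] by blast
  obtain q1 where q1 [measurable]: "q1 \<in> borel_measurable borel" and q1_fin: "(\<integral>\<^sup>+ r. q1 r \<partial>lborel) < \<infinity>"
    and q1_le: "\<And>s t. 0 \<le> s \<Longrightarrow> s < t \<Longrightarrow> t \<le> 1 \<Longrightarrow>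
      ennreal ((inner h1 (innovation s t))\<^sup>2) \<le> ennreal (2 * M\<^sup>2 * (t - s)\<^sup>2) * hardy_kernel q1 s t"
    using inner_innovation_hardy[of h1] by blast
  obtain q2 where q2 [measurable]: "q2 \<in> borel_measurable borel" and q2_fin: "(\<integral>\<^sup>+ r. q2 r \<partial>lborel) < \<infinity>"
    and q2_le: "\<And>s t. 0 \<le> s \<Longrightarrow> s < t \<Longrightarrow> t \<le> 1 \<Longrightarrow>
      ennreal ((inner h2 (innovation s t))\<^sup>2) \<le> ennreal (2 * M\<^sup>2 * (t - s)\<^sup>2) * hardy_kernel q2 s t"
    using inner_innovation_hardy[of h2] by blast
  \<comment> \<open>The Hardy constant \<open>2 * M^2\<close>, divided by the square of the lower
    bound \<open>c\<close>; \<open>\<beta>\<close> is the nonsingular contribution of the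
    past.\<close>
  define \<alpha> where "\<alpha> = ennreal (2 * M\<^sup>2 / c\<^sup>2)"
  define \<beta> where "\<beta> = ennreal (L\<^sup>2 * ((norm h1)\<^sup>2 + (norm h2)\<^sup>2) / c\<^sup>2)"
  \<comment> \<open>Vanishing unless \<open>0 \<le> s < t \<le> 1\<close> makes \<open>F\<close>
    integrable over the whole line, as the chain bound requires.\<close>
  define F where "F s t = (if 0 \<le> s \<and> s < t \<and> t \<le> 1
      then \<alpha> * (hardy_kernel q1 s t + hardy_kernel q2 s t) + \<beta> else 0)" for s t
  define B where "B = \<alpha> * (2 * (\<integral>\<^sup>+ r. q1 r \<partial>lborel) + 2 * (\<integral>\<^sup>+ r. q2 r \<partial>lborel)) + \<beta>"
  have B_fin: "B < \<infinity>"
    using q1_fin q2_fin by (simp add: B_def \<alpha>_def \<beta>_def ennreal_mult_less_top)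
  have F_meas: "(\<lambda>(s, t). F s t) \<in> borel_measurable (borel \<Otimes>\<^sub>M borel)"
    unfolding F_def by measurable
  have F_int: "(\<integral>\<^sup>+ t. F s t \<partial>lborel) \<le> B" for s
  proof (cases "0 \<le> s")
    case True
    have [measurable]: "hardy_kernel q s \<in> borel_measurable borel" if "q \<in> borel_measurable borel" for q
      using measurable_compose[OF measurable_Pair1' measurable_hardy_kernel[OF that], of s] by simp
    \<comment> \<open>Enlarging the range of \<open>\<beta>\<close> to [0,1] makes the bound
      independent of \<open>s\<close>.\<close>
    have "(\<integral>\<^sup>+ t. F s t \<partial>lborel) \<le> (\<integral>\<^sup>+ t. \<alpha> * (hardy_kernel q1 s t * indicator {s<..1} t + hardy_kernel q2 s t * indicator {s<..1} t)
        + \<beta> * indicator {0..1} t \<partial>lborel)"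
      using True by (intro nn_integral_mono) (auto simp: F_def indicator_def)
    also have "\<dots> = \<alpha> * ((\<integral>\<^sup>+ t. hardy_kernel q1 s t * indicator {s<..1} t \<partial>lborel) +
        (\<integral>\<^sup>+ t. hardy_kernel q2 s t * indicator {s<..1} t \<partial>lborel)) + \<beta>"
      by (simp add: nn_integral_add nn_integral_cmult)
    also have "\<dots> \<le> B"
      unfolding B_def by (intro add_mono mult_left_mono nn_integral_hardy_kernel_le) auto
    finally show ?thesis .
  qed (simp add: F_def)
  have bound: "ennreal \<bar>rosen_integrand \<gamma>' k h1 h2 t\<bar> \<le> (\<Prod>i\<in>{1..k - 1}. F (t i) (t (i + 1)))"
    if t: "t \<in> time_simplex k" for t
  proof -
    let ?f = "\<lambda>i. 1 / (norm (orth_incr \<gamma>' t i))\<^sup>2 *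
     (exp (- (1 / 2) * ((inner h1 (orth_incr \<gamma>' t i))\<^sup>2 / (norm (orth_incr \<gamma>' t i))\<^sup>2
        + (inner h2 (orth_incr \<gamma>' t i))\<^sup>2 / (norm (orth_incr \<gamma>' t i))\<^sup>2)) - 1)"
    have "ennreal \<bar>?f i\<bar> \<le> F (t i) (t (i + 1))" if i: "i \<in> {1..k - 1}" for i
    \<comment> \<open>For coinciding times the factor is \<open>0\<close> by the convention for
      division by zero, matching \<open>F\<close> there.\<close>
    proof (cases "t i = t (i + 1)")
      case True
      then have "orth_incr \<gamma>' t i = 0"
        by (intro orth_incr_eq_0) simp
      then show ?thesis
        by simp
    next
      case False
      define s where "s = t i"
      define u where "u = t (i + 1)"
      have "1 \<le> i" "i \<le> k" "i + 1 \<le> k"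
        using i by auto
      then have su: "0 \<le> s" "s < u" "u \<le> 1"
        using False simplex(1)[OF t, of i] simplex(1)[OF t, of "i + 1"] simplex(2)[OF t, of i "i + 1"]
        by (auto simp: s_def u_def)
      have "\<bar>?f i\<bar> \<le> ((inner h1 (innovation s u))\<^sup>2 + (inner h2 (innovation s u))\<^sup>2) / (c\<^sup>2 * (u - s)\<^sup>2)
          + L\<^sup>2 * ((norm h1)\<^sup>2 + (norm h2)\<^sup>2) / c\<^sup>2"
        unfolding s_def u_def
        by (rule rosen_factor_le)
          (use i su c simplex[OF t] in \<open>auto simp: s_def u_def intro!: \<gamma>'\<close>)
      then have "ennreal \<bar>?f i\<bar> \<le> ennreal (((inner h1 (innovation s u))\<^sup>2 + (inner h2 (innovation s u))\<^sup>2) / (c\<^sup>2 * (u - s)\<^sup>2)) + \<beta>"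
        unfolding \<beta>_def by (subst ennreal_plus[symmetric]) (simp_all only: ennreal_leI, simp_all)
      also have "ennreal (((inner h1 (innovation s u))\<^sup>2 + (inner h2 (innovation s u))\<^sup>2) / (c\<^sup>2 * (u - s)\<^sup>2)) =
          ennreal (1 / (c\<^sup>2 * (u - s)\<^sup>2)) * (ennreal ((inner h1 (innovation s u))\<^sup>2) + ennreal ((inner h2 (innovation s u))\<^sup>2))"
        by (simp add: ennreal_mult'[symmetric] flip: ennreal_plus)
      also have "\<dots> \<le> ennreal (1 / (c\<^sup>2 * (u - s)\<^sup>2)) * (ennreal (2 * M\<^sup>2 * (u - s)\<^sup>2) * hardy_kernel q1 s u
          + ennreal (2 * M\<^sup>2 * (u - s)\<^sup>2) * hardy_kernel q2 s u)"
        using su by (intro mult_left_mono add_mono q1_le q2_le) auto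
      also have "\<dots> = (ennreal (1 / (c\<^sup>2 * (u - s)\<^sup>2)) * ennreal (2 * M\<^sup>2 * (u - s)\<^sup>2)) * (hardy_kernel q1 s u + hardy_kernel q2 s u)"
        by (simp add: distrib_left mult.assoc)
      also have "ennreal (1 / (c\<^sup>2 * (u - s)\<^sup>2)) * ennreal (2 * M\<^sup>2 * (u - s)\<^sup>2) = \<alpha>"
        using su c by (simp add: \<alpha>_def ennreal_mult'[symmetric] field_simps)
      finally have "ennreal \<bar>?f i\<bar> \<le> \<alpha> * (hardy_kernel q1 s u + hardy_kernel q2 s u) + \<beta>"
        by (simp add: add_mono)
      then show ?thesis
        using su by (simp add: F_def s_def u_def)
    qed
    then have "(\<Prod>i\<in>{1..k - 1}. ennreal \<bar>?f i\<bar>) \<le> (\<Prod>i\<in>{1..k - 1}. F (t i) (t (i + 1)))"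
      by (rule prod_mono_ennreal)
    then show ?thesis
      unfolding rosen_integrand_eq abs_prod by (subst prod_ennreal[symmetric]) auto
  qed
  have "(\<integral>\<^sup>+ t. norm (indicator (time_simplex k) t *\<^sub>R rosen_integrand \<gamma>' k h1 h2 t) \<partial>?N)
      \<le> (\<integral>\<^sup>+ t. indicator {0..1} (t 1) * (\<Prod>i\<in>{1..k - 1}. F (t i) (t (i + 1))) \<partial>?N)"
  proof (rule nn_integral_mono)
    fix t
    show "ennreal (norm (indicator (time_simplex k) t *\<^sub>R rosen_integrand \<gamma>' k h1 h2 t))
        \<le> indicator {0..1} (t 1) * (\<Prod>i\<in>{1..k - 1}. F (t i) (t (i + 1)))"
      using bound[of t] simplex(1)[of t 1] assms(2) by (cases "t \<in> time_simplex k") auto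
  qed
  also have "\<dots> \<le> B ^ (k - 1)"
    using nn_integral_PiM_chain_le[OF F_meas F_int, of "k - 1"] assms(2) by simp
  also have "\<dots> < \<infinity>"
    using B_fin by (simp add: power_less_top_ennreal)
  finally have "integrable ?N (\<lambda>t. indicator (time_simplex k) t *\<^sub>R rosen_integrand \<gamma>' k h1 h2 t)"
    by (intro integrableI_bounded) measurable
  moreover have "indicator (time_simplex k) t *\<^sub>R rosen_integrand \<gamma>' k h1 h2 t =
      indicator (time_simplex k) t *\<^sub>R rosen_integrand \<gamma> k h1 h2 t" for t
    using simplex(1)[of t] rosen_integrand_cong[of k \<gamma>' t \<gamma> h1 h2] \<gamma> \<gamma>'
    by (cases "t \<in> time_simplex k") auto
  ultimately show "set_integrable ?N (time_simplex k) (rosen_integrand \<gamma> k h1 h2)"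
    unfolding set_integrable_def by (simp only:)
qed

end

section \<open>Reduction to a Lipschitz kernel on the whole line\<close>

theorem theorem4p1:
  fixes K K' :: "real \<Rightarrow> real" and g :: "real \<Rightarrow> L2" and k :: nat
  assumes "\<And>x. x \<in> {0..1} \<Longrightarrow> (K has_real_derivative K' x) (at x within {0..1})"
    and "continuous_on {0..1} K'"
    and "K 0 \<noteq> 0"
    and "\<And>t. t \<in> {0..1} \<Longrightarrow> g t = to_L2 (\<lambda>s. K (t - s) * indicator {0..t} s)"
    and "k \<ge> 2"
  shows "rosen_local_time_exists g k"
proof -
  \<comment> \<open>Clamping to [0,1] does not increase distances, so composing with it extends
    \<open>K\<close> while keeping its bound and Lipschitz constant.\<close>
  define \<pi> :: "real \<Rightarrow> real" where "\<pi> x = max 0 (min 1 x)" for x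
  have \<pi>: "\<pi> x \<in> {0..1}" "\<bar>\<pi> x - \<pi> y\<bar> \<le> \<bar>x - y\<bar>" for x y
    by (auto simp: \<pi>_def)
  have "continuous_on {0..1} K"
    using assms(1) by (meson DERIV_continuous continuous_on_eq_continuous_within)
  then obtain M where M: "\<And>x. x \<in> {0..1} \<Longrightarrow> \<bar>K x\<bar> \<le> M"
    using compact_imp_bounded[OF compact_continuous_image[OF _ compact_Icc]]
    by (fastforce simp: bounded_iff)
  obtain L where L: "\<And>x. x \<in> {0..1} \<Longrightarrow> \<bar>K' x\<bar> \<le> L"
    using compact_imp_bounded[OF compact_continuous_image[OF assms(2) compact_Icc]]
    by (fastforce simp: bounded_iff)
  have "0 \<le> L"
    using L[of 0] by simp
  interpret volterra_kernel "\<lambda>x. K (\<pi> x)" M L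
  proof
    show "\<bar>K (\<pi> x)\<bar> \<le> M" for x
      using M \<pi> by blast
    show "\<bar>K (\<pi> x) - K (\<pi> y)\<bar> \<le> L * \<bar>x - y\<bar>" for x y
    proof -
      have "\<bar>K (\<pi> x) - K (\<pi> y)\<bar> \<le> L * \<bar>\<pi> x - \<pi> y\<bar>"
        using field_differentiable_bound[of "{0..1}" K K' L "\<pi> x" "\<pi> y"] assms(1) L \<pi> by simp
      also have "\<dots> \<le> L * \<bar>x - y\<bar>"
        by (intro mult_left_mono \<pi> \<open>0 \<le> L\<close>)
      finally show ?thesis .
    qed
  qed
  show ?thesis
  proof (rule rosen_local_time_exists_curve)
    \<comment> \<open>For \<open>u\<close> in [0,1] and \<open>r\<close> in \<open>{0..u}\<close>
      the argument \<open>u - r\<close> lies in [0,1], where clamping changes nothing.\<close>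
    show "g u = curve u" if "u \<in> {0..1}" for u
      unfolding assms(4)[OF that] curve_def
      by (rule arg_cong[where f=to_L2]) (use that in \<open>auto simp: fun_eq_iff indicator_def \<pi>_def\<close>)
  qed (use assms in \<open>auto simp: \<pi>_def\<close>)
qed

end
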